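(* Given an abelian ideal $\mathfrak i\in\mathcal I_{ab}$ of $\mathfrak b$, the following conditions are equivalent: (1) $[\mathfrak n_{\langle\mathfrak i\rangle},\mathfrak n_{\langle\mathfrak i\rangle}]\subset\mathfrak i=\mathrm{cent}\,\mathfrak n_{\langle\mathfrak i\rangle}$. (2) $\Phi_{\mathfrak i}=\Delta_\tau^2$ for some $\tau\in X$.
   Context: $\mathfrak g$ is a finite-dimensional complex simple Lie algebra, $\mathfrak b=\mathfrak h\oplus\mathfrak n$ a Borel subalgebra with Cartan subalgebra $\mathfrak h$ and nilradical $\mathfrak n$, $\Delta$, $\Delta^+$, $\Pi=\{\alpha_1,\dots,\alpha_n\}$, $\theta$ the roots, positive roots, simple roots and highest root, $\mathfrak g_\alpha$ the root spaces. $\mathfrak h_{\mathbb R}$ is the real span of the coroots, identified with $\mathfrak h_{\mathbb R}^*$ via the Killing form, $(\cdot,\cdot)$ the form/pairing; $P^\vee$ is the coweight lattice. $X=\{x\in P^\vee\mid(x,\alpha_i)\ge0\ \forall i,\ (x,\theta)\le2\}$. $\mathcal I_{ab}$ is the set of abelian ideals of $\mathfrak b$ (they lie in $\mathfrak n$; the zero ideal is allowed). For such $\mathfrak i$, $\Phi_{\mathfrak i}=\{\alpha\in\Delta^+\mid\mathfrak g_\alpha\subset\mathfrak i\}$ and $\langle\mathfrak i\rangle=\sum_{\alpha\in\Phi_{\mathfrak i}}\alpha$. For $x\in\mathfrak h_{\mathbb R}$, $\mathfrak n_x=\sum_{\alpha\in\Delta^+,\,(\alpha,x)>0}\mathfrak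 g_\alpha$, and $\mathrm{cent}\,\mathfrak n_x$ is the center of $\mathfrak n_x$. $\Delta_\tau^i=\{\alpha\in\Delta^+\mid(\alpha,\tau)=i\}$. *)

theory Defs
  imports Complex_Main
begin

text \<open>
  A finite-dimensional complex Lie algebra is carried by a whole type \<open>'g\<close>. Its subalgebras
  and ideals are subsets of \<open>'g\<close>.
\<close>

locale lie_algebra = vector_space scale
  for scale :: "complex \<Rightarrow> 'g::ab_group_add \<Rightarrow> 'g" +
  fixes lie :: "'g \<Rightarrow> 'g \<Rightarrow> 'g"
  assumes finite_dimensional: "\<exists>B. finite B \<and> span B = UNIV"
    and linear_left: "Vector_Spaces.linear scale scale (\<lambda>x. lie x y)"
    and linear_right: "Vector_Spaces.linear scale scale (\<lambda>y. lie x y)"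
    and alternating: "lie x x = 0"
    and jacobi: "lie x (lie y z) + lie y (lie z x) + lie z (lie x y) = 0"
begin

definition bracket :: "'g set \<Rightarrow> 'g set \<Rightarrow> 'g set" where
  "bracket A B = span {lie x y | x y. x \<in> A \<and> y \<in> B}"

definition subalgebra :: "'g set \<Rightarrow> bool" where
  "subalgebra A \<longleftrightarrow> subspace A \<and> bracket A A \<subseteq> A"

definition ideal :: "'g set \<Rightarrow> 'g set \<Rightarrow> bool" where
  "ideal I A \<longleftrightarrow> subspace I \<and> I \<subseteq> A \<and> bracket A I \<subseteq> I"

definition abelian :: "'g set \<Rightarrow> bool" where
  "abelian A \<longleftrightarrow> (\<forall>x\<in>A. \<forall>y\<in>A. lie x y = 0)"

definition center :: "'g set \<Rightarrow> 'g set" where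
  "center A = {x \<in> A. \<forall>y\<in>A. lie x y = 0}"

primrec derived_series :: "'g set \<Rightarrow> nat \<Rightarrow> 'g set" where
  "derived_series A 0 = A"
| "derived_series A (Suc k) = bracket (derived_series A k) (derived_series A k)"

primrec lower_central_series :: "'g set \<Rightarrow> nat \<Rightarrow> 'g set" where
  "lower_central_series A 0 = A"
| "lower_central_series A (Suc k) = bracket A (lower_central_series A k)"

definition solvable :: "'g set \<Rightarrow> bool" where
  "solvable A \<longleftrightarrow> (\<exists>k. derived_series A k = {0})"

definition nilpotent :: "'g set \<Rightarrow> bool" where
  "nilpotent A \<longleftrightarrow> (\<exists>k. lower_central_series A k = {0})"

definition simple :: bool where
  "simple \<longleftrightarrow> \<not> abelian UNIV \<and> (\<forall>I. ideal I UNIV \<longrightarrow> I = {0} \<or> I = UNIV)"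

text \<open>
  Cartan subalgebras are only used in semisimple Lie algebras, where we take the usual definition
  for that setting: a toral subalgebra (abelian, all of whose elements are ad-diagonalizable) that
  coincides with its centralizer.
\<close>

definition ad_diagonalizable :: "'g \<Rightarrow> bool" where
  "ad_diagonalizable x \<longleftrightarrow> span {v. \<exists>c. lie x v = scale c v} = UNIV"

definition cartan_subalgebra :: "'g set \<Rightarrow> bool" where
  "cartan_subalgebra \<hh> \<longleftrightarrow>
     subalgebra \<hh> \<and> abelian \<hh> \<and> (\<forall>x\<in>\<hh>. ad_diagonalizable x) \<and>
     {x. \<forall>y\<in>\<hh>. lie x y = 0} = \<hh>"

definition borel_subalgebra :: "'g set \<Rightarrow> bool" where
  "borel_subalgebra \<bb> \<longleftrightarrow>
     subalgebra \<bb> \<and> solvable \<bb> \<and>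
     (\<forall>\<cc>. subalgebra \<cc> \<and> solvable \<cc> \<and> \<bb> \<subseteq> \<cc> \<longrightarrow> \<cc> = \<bb>)"

definition is_nilradical :: "'g set \<Rightarrow> 'g set \<Rightarrow> bool" where
  "is_nilradical \<nn> \<bb> \<longleftrightarrow>
     ideal \<nn> \<bb> \<and> nilpotent \<nn> \<and> (\<forall>I. ideal I \<bb> \<and> nilpotent I \<longrightarrow> I \<subseteq> \<nn>)"

definition is_direct_sum :: "'g set \<Rightarrow> 'g set \<Rightarrow> 'g set \<Rightarrow> bool" where
  "is_direct_sum A B C \<longleftrightarrow> A = {x + y | x y. x \<in> B \<and> y \<in> C} \<and> B \<inter> C = {0}"

text \<open>\<open>extend_basis {}\<close> is an arbitrarily chosen basis of \<open>'g\<close>; the trace does not depend on it.\<close>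

definition trace :: "('g \<Rightarrow> 'g) \<Rightarrow> complex" where
  "trace f = (\<Sum>v\<in>extend_basis {}. representation (extend_basis {}) (f v) v)"

definition killing :: "'g \<Rightarrow> 'g \<Rightarrow> complex" where
  "killing x y = trace (\<lambda>z. lie x (lie y z))"

text \<open>
  An element of the dual of \<open>\<hh>\<close> is represented by the function on \<open>'g\<close> that is linear on \<open>\<hh>\<close>
  and zero outside \<open>\<hh>\<close>. The representative is unique, and pointwise linear combinations of
  representatives are representatives.
\<close>

definition dual_space :: "'g set \<Rightarrow> ('g \<Rightarrow> complex) set" where
  "dual_space \<hh> = {\<alpha>. (\<forall>x\<in>\<hh>. \<forall>y\<in>\<hh>. \<alpha> (x + y) = \<alpha> x + \<alpha> y) \<and>
                       (\<forall>c. \<forall>x\<in>\<hh>. \<alpha> (scale c x) = c * \<alpha> x) \<and>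
                       (\<forall>x. x \<notin> \<hh> \<longrightarrow> \<alpha> x = 0)}"

definition root_space :: "'g set \<Rightarrow> ('g \<Rightarrow> complex) \<Rightarrow> 'g set" where
  "root_space \<hh> \<alpha> = {x. \<forall>y\<in>\<hh>. lie y x = scale (\<alpha> y) x}"

definition roots :: "'g set \<Rightarrow> ('g \<Rightarrow> complex) set" where
  "roots \<hh> = {\<alpha> \<in> dual_space \<hh>. \<alpha> \<noteq> (\<lambda>_. 0) \<and> root_space \<hh> \<alpha> \<noteq> {0}}"

definition pos_roots :: "'g set \<Rightarrow> 'g set \<Rightarrow> ('g \<Rightarrow> complex) set" where
  "pos_roots \<hh> \<nn> = {\<alpha> \<in> roots \<hh>. root_space \<hh> \<alpha> \<subseteq> \<nn>}"

definition simple_roots :: "'g set \<Rightarrow> 'g set \<Rightarrow> ('g \<Rightarrow> complex) set" where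
  "simple_roots \<hh> \<nn> =
     {\<alpha> \<in> pos_roots \<hh> \<nn>. \<not> (\<exists>\<beta>\<in>pos_roots \<hh> \<nn>. \<exists>\<gamma>\<in>pos_roots \<hh> \<nn>. \<alpha> = (\<lambda>x. \<beta> x + \<gamma> x))}"

definition is_highest_root :: "'g set \<Rightarrow> 'g set \<Rightarrow> ('g \<Rightarrow> complex) \<Rightarrow> bool" where
  "is_highest_root \<hh> \<nn> \<theta> \<longleftrightarrow>
     \<theta> \<in> roots \<hh> \<and>
     (\<forall>\<alpha>\<in>roots \<hh>. \<exists>c :: ('g \<Rightarrow> complex) \<Rightarrow> nat.
        \<forall>x. \<theta> x - \<alpha> x = (\<Sum>\<beta>\<in>simple_roots \<hh> \<nn>. of_nat (c \<beta>) * \<beta> x))"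

text \<open>The identification of the dual of \<open>\<hh>\<close> with \<open>\<hh>\<close> given by the Killing form.\<close>

definition killing_dual :: "'g set \<Rightarrow> ('g \<Rightarrow> complex) \<Rightarrow> 'g" where
  "killing_dual \<hh> \<alpha> = (THE t. t \<in> \<hh> \<and> (\<forall>x\<in>\<hh>. killing t x = \<alpha> x))"

text \<open>
  \<open>\<alpha> (killing_dual \<hh> \<alpha>)\<close> is the square length of \<open>\<alpha>\<close> for the form induced by the Killing form.
\<close>

definition coroot :: "'g set \<Rightarrow> ('g \<Rightarrow> complex) \<Rightarrow> 'g" where
  "coroot \<hh> \<alpha> = scale (2 / \<alpha> (killing_dual \<hh> \<alpha>)) (killing_dual \<hh> \<alpha>)"

definition real_form :: "'g set \<Rightarrow> 'g set" where
  "real_form \<hh> = module.span (\<lambda>r. scale (complex_of_real r)) (coroot \<hh> ` roots \<hh>)"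

text \<open>Roots take real values on \<open>real_form \<hh>\<close>, so there \<open>pairing \<alpha> x\<close> is \<open>\<alpha> x\<close>.\<close>

definition pairing :: "('g \<Rightarrow> complex) \<Rightarrow> 'g \<Rightarrow> real" where
  "pairing \<alpha> x = Re (\<alpha> x)"

definition coweight_lattice :: "'g set \<Rightarrow> 'g set" where
  "coweight_lattice \<hh> = {x \<in> real_form \<hh>. \<forall>\<alpha>\<in>roots \<hh>. pairing \<alpha> x \<in> \<int>}"

definition X :: "'g set \<Rightarrow> 'g set \<Rightarrow> ('g \<Rightarrow> complex) \<Rightarrow> 'g set" where
  "X \<hh> \<nn> \<theta> =
     {x \<in> coweight_lattice \<hh>. (\<forall>\<alpha>\<in>simple_roots \<hh> \<nn>. pairing \<alpha> x \<ge> 0) \<and> pairing \<theta> x \<le> 2}"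

definition roots_of :: "'g set \<Rightarrow> 'g set \<Rightarrow> 'g set \<Rightarrow> ('g \<Rightarrow> complex) set" where
  "roots_of \<hh> \<nn> \<ii> = {\<alpha> \<in> pos_roots \<hh> \<nn>. root_space \<hh> \<alpha> \<subseteq> \<ii>}"

definition root_sum :: "'g set \<Rightarrow> 'g set \<Rightarrow> 'g set \<Rightarrow> ('g \<Rightarrow> complex)" where
  "root_sum \<hh> \<nn> \<ii> = (\<lambda>x. \<Sum>\<alpha>\<in>roots_of \<hh> \<nn> \<ii>. \<alpha> x)"

definition nil_part :: "'g set \<Rightarrow> 'g set \<Rightarrow> 'g \<Rightarrow> 'g set" where
  "nil_part \<hh> \<nn> x = span (\<Union>\<alpha>\<in>{\<alpha> \<in> pos_roots \<hh> \<nn>. pairing \<alpha> x > 0}. root_space \<hh> \<alpha>)"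

definition graded_roots :: "'g set \<Rightarrow> 'g set \<Rightarrow> 'g \<Rightarrow> real \<Rightarrow> ('g \<Rightarrow> complex) set" where
  "graded_roots \<hh> \<nn> \<tau> i = {\<alpha> \<in> pos_roots \<hh> \<nn>. pairing \<alpha> \<tau> = i}"

end

end

theory Submission
  imports Defs "HOL-Library.Function_Algebras"
begin

text \<open>
  As \<open>\<gg>\<close> is simple with a given toral self-centralizing \<open>\<hh>\<close>, nondegeneracy of the Killing form
  does not need Cartan's criterion: comparing traces along root strings shows that \<open>t = [x, y]\<close> with
  \<open>x \<in> \<gg>\<^sub>\<alpha>\<close>, \<open>y \<in> \<gg>\<^bsub>-\<alpha>\<^esub>\<close> and \<open>t \<noteq> 0\<close> has \<open>\<alpha>(t) \<noteq> 0\<close> and nonzero Killing square. The positive roots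
  of the Borel subalgebra exhaust the roots up to sign because a closed set of roots without
  opposite pairs has no vanishing sums, hence gives a solvable subalgebra.

  Write \<open>s\<close> for \<open>\<langle>\<ii>\<rangle>\<close> and \<open>N\<close> for the positive roots \<open>\<gamma>\<close> with \<open>(\<gamma>, s) > 0\<close>. Since \<open>\<Phi>\<close> is an upper set,
  \<open>s\<close> is dominant, and \<open>(\<gamma>, s) = 0\<close> forces the reflection in \<open>\<gamma>\<close> to preserve \<open>\<Phi>\<close>.
  If \<open>\<Phi>\<close> is the level \<open>2\<close> of \<open>\<tau>\<close>, then \<open>N\<close> lies in the levels \<open>1\<close> and \<open>2\<close> and contains \<open>\<Phi>\<close>. A root \<open>\<gamma> \<in> N\<close> of
  level \<open>1\<close> is not central: for some \<open>\<alpha> \<in> \<Phi>\<close> the difference \<open>\<alpha> - \<gamma>\<close> is a root, again in \<open>N\<close>.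
  Conversely, the condition on brackets and center makes the function that is \<open>2\<close> on \<open>\<Phi>\<close>, \<open>1\<close> on the
  rest of \<open>N\<close> and \<open>0\<close> on the other positive roots additive on roots, and an additive function
  on roots is the pairing with a coweight.
\<close>

section \<open>Joint eigenspaces\<close>

context lie_algebra
begin

section \<open>Bilinearity, the derivation rule and brackets of spans\<close>

lemma lie_add_left: "lie (x + y) z = lie x z + lie y z"
  and lie_scale_left: "lie (scale c x) z = scale c (lie x z)"
  using linear_left[of z] by (auto simp: Vector_Spaces.linear_iff)

lemma lie_add_right: "lie z (x + y) = lie z x + lie z y"
  and lie_scale_right: "lie z (scale c x) = scale c (lie z x)"
  using linear_right[of z] by (auto simp: Vector_Spaces.linear_iff)

lemma lie_zero_left [simp]: "lie 0 z = 0"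
  using lie_scale_left[of 0 0 z] by simp

lemma lie_zero_right [simp]: "lie z 0 = 0"
  using lie_scale_right[of z 0 0] by simp

lemma lie_minus_right [simp]: "lie z (- x) = - lie z x"
  using lie_scale_right[of z "-1" x] by simp

lemma lie_diff_right: "lie z (x - y) = lie z x - lie z y"
  using lie_add_right[of z x "-y"] by simp

lemma lie_sum_right: "lie z (sum f A) = (\<Sum>i\<in>A. lie z (f i))"
  by (induction A rule: infinite_finite_induct) (auto simp: lie_add_right)

lemma lie_anticomm: "lie y x = - lie x y"
proof -
  have "lie (x + y) (x + y) = 0" by (rule alternating)
  then have "lie y x + lie x y = 0"
    by (simp add: lie_add_left lie_add_right alternating[of x] alternating[of y])
  then show ?thesis by (simp add: eq_neg_iff_add_eq_0)
qed

lemma lie_leibniz: "lie x (lie y z) = lie (lie x y) z + lie y (lie x z)"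
proof -
  have "lie y (lie z x) = - lie y (lie x z)"
    by (metis lie_anticomm lie_minus_right)
  moreover have "lie z (lie x y) = - lie (lie x y) z" by (rule lie_anticomm)
  ultimately show ?thesis
    using jacobi[of x y z] by (simp add: algebra_simps)
qed

lemma lie_lie_left: "lie (lie x y) z = lie x (lie y z) - lie y (lie x z)"
  using lie_leibniz[of x y z] by simp

text \<open>Bilinearity lets the inclusion be tested on spanning sets; span induction runs first in
  the right argument, then in the left.\<close>

lemma bracket_span_subset:
  assumes "subspace U" "\<And>x y. x \<in> S \<Longrightarrow> y \<in> T \<Longrightarrow> lie x y \<in> U"
  shows "bracket (span S) (span T) \<subseteq> U"
proof -
  have 1: "lie x y \<in> U" if "x \<in> S" "y \<in> span T" for x y
    using that(2)
  proof (induction rule: span_induct_alt)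
    case base then show ?case using assms(1) by (simp add: subspace_0)
  next
    case (step c a y)
    then show ?case using assms that(1)
      by (auto simp: lie_add_right lie_scale_right intro!: subspace_add subspace_scale)
  qed
  have 2: "lie x y \<in> U" if "x \<in> span S" "y \<in> span T" for x y
    using that(1)
  proof (induction rule: span_induct_alt)
    case base then show ?case using assms(1) by (simp add: subspace_0)
  next
    case (step c a x)
    then show ?case using assms(1) 1[OF step(1) that(2)]
      by (auto simp: lie_add_left lie_scale_left intro!: subspace_add subspace_scale)
  qed
  show ?thesis
    unfolding bracket_def using 2 assms(1) by (intro span_minimal) auto
qed

lemma lie_mem_bracket: "x \<in> A \<Longrightarrow> y \<in> B \<Longrightarrow> lie x y \<in> bracket A B"
  unfolding bracket_def by (rule span_base) auto

lemma bracket_subset_iff: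
  assumes "subspace U"
  shows "bracket A B \<subseteq> U \<longleftrightarrow> (\<forall>x\<in>A. \<forall>y\<in>B. lie x y \<in> U)"
proof
  show "bracket A B \<subseteq> U \<Longrightarrow> \<forall>x\<in>A. \<forall>y\<in>B. lie x y \<in> U"
    using lie_mem_bracket by blast
  assume "\<forall>x\<in>A. \<forall>y\<in>B. lie x y \<in> U"
  then show "bracket A B \<subseteq> U"
    unfolding bracket_def using assms by (intro span_minimal) auto
qed

lemma subspace_root_space: "subspace (root_space H \<rho>)"
  unfolding root_space_def
  by (rule subspaceI) (auto simp: lie_add_right lie_scale_right algebra_simps scale_right_distrib)

text \<open>Each \<open>lie y\<close> is a derivation, so eigenvalues add.\<close>

lemma root_space_lie:
  assumes "x \<in> root_space H \<rho>" "y \<in> root_space H \<mu>"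
  shows "lie x y \<in> root_space H (\<rho> + \<mu>)"
  using assms unfolding root_space_def
  by (simp add: lie_leibniz[of _ x y] lie_scale_left lie_scale_right scale_left_distrib)

text \<open>Distinct eigenvalues are separated by polynomials in the operators.\<close>

lemma weight_components_mem:
  assumes "finite F" "subspace U" "\<And>y u. y \<in> H \<Longrightarrow> u \<in> U \<Longrightarrow> lie y u \<in> U"
    and "\<And>\<rho>. \<rho> \<in> F \<Longrightarrow> c \<rho> \<in> root_space H \<rho>"
    and "\<And>\<rho> \<mu>. \<rho> \<in> F \<Longrightarrow> \<mu> \<in> F \<Longrightarrow> \<rho> \<noteq> \<mu> \<Longrightarrow> \<exists>y\<in>H. \<rho> y \<noteq> \<mu> y"
    and "sum c F \<in> U" "\<rho> \<in> F"
  shows "c \<rho> \<in> U"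
  using assms
proof (induction F arbitrary: c \<rho> rule: finite_psubset_induct)
  case (psubset F)
  show ?case
  proof (cases "F = {\<rho>}")
    case True then show ?thesis using psubset.prems(5) by simp
  next
    case False
    then obtain \<mu> where \<mu>: "\<mu> \<in> F" "\<mu> \<noteq> \<rho>" using psubset.prems(6) by auto
    then obtain y where y: "y \<in> H" "\<rho> y \<noteq> \<mu> y" using psubset.prems(4,6) by metis
    \<comment> \<open>Applying \<open>lie y\<close> minus the scalar \<open>\<mu> y\<close> kills
      the component at \<mu> and multiplies the one at \<rho> by a non-zero factor.\<close>
    define c' where "c' \<nu> = scale (\<nu> y - \<mu> y) (c \<nu>)" for \<nu>
    have c': "c' \<nu> = lie y (c \<nu>) - scale (\<mu> y) (c \<nu>)" if "\<nu> \<in> F" for \<nu>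
      using psubset.prems(3)[OF that] y(1) by (simp add: c'_def root_space_def scale_left_diff_distrib)
    have "sum c' (F - {\<mu>}) = sum c' F"
      using \<mu> psubset.hyps by (simp add: sum.remove c'_def)
    also have "\<dots> = (\<Sum>\<nu>\<in>F. lie y (c \<nu>) - scale (\<mu> y) (c \<nu>))"
      by (rule sum.cong) (auto simp: c')
    also have "\<dots> = lie y (sum c F) - scale (\<mu> y) (sum c F)"
      by (simp add: lie_sum_right sum_subtractf scale_sum_right)
    also have "\<dots> \<in> U"
      using psubset.prems(1,2,5) y(1) by (intro subspace_diff subspace_scale) auto
    finally have s: "sum c' (F - {\<mu>}) \<in> U" .
    have "c' \<rho> \<in> U"
    proof (rule psubset.IH[of "F - {\<mu>}"])
      show "F - {\<mu>} \<subset> F" using \<mu> by auto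
      show "c' \<nu> \<in> root_space H \<nu>" if "\<nu> \<in> F - {\<mu>}" for \<nu>
        using psubset.prems(3) that unfolding c'_def
        by (intro subspace_scale subspace_root_space) auto
    qed (use psubset.prems \<mu> s in auto)
    then have "scale (inverse (\<rho> y - \<mu> y)) (c' \<rho>) \<in> U"
      using psubset.prems(1) by (rule subspace_scale[rotated])
    then show ?thesis using y(2) by (simp add: c'_def)
  qed
qed

text \<open>Terms of equal weight are merged, so that each weight contributes one component and
  \<open>weight_components_mem\<close> becomes applicable.\<close>

lemma span_weight_decomp:
  assumes "v \<in> span (\<Union>\<rho>\<in>L. root_space H \<rho>)"
  shows "\<exists>F c. finite F \<and> F \<subseteq> L \<and> (\<forall>\<rho>\<in>F. c \<rho> \<in> root_space H \<rho>) \<and> v = sum c F"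
  using assms
proof (induction rule: span_induct_alt)
  case base
  show ?case by (rule exI[of _ "{}"]) auto
next
  case (step k a y)
  then obtain \<rho> F c where *: "\<rho> \<in> L" "a \<in> root_space H \<rho>" "finite F" "F \<subseteq> L"
    "\<forall>\<rho>\<in>F. c \<rho> \<in> root_space H \<rho>" "y = sum c F" by auto
  define c' where "c' \<mu> = (if \<mu> = \<rho> then scale k a + (if \<rho> \<in> F then c \<rho> else 0) else c \<mu>)" for \<mu>
  have "sum c' (insert \<rho> F) = c' \<rho> + sum c' (F - {\<rho>})"
    using *(3) by (simp add: sum.insert_remove)
  also have "sum c' (F - {\<rho>}) = sum c (F - {\<rho>})"
    by (rule sum.cong) (auto simp: c'_def)
  also have "c' \<rho> + sum c (F - {\<rho>}) = scale k a + y"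
    using *(3,6) by (auto simp: c'_def sum.remove[of F \<rho>] add.assoc)
  finally have "scale k a + y = sum c' (insert \<rho> F)" by simp
  moreover have "c' \<mu> \<in> root_space H \<mu>" if "\<mu> \<in> insert \<rho> F" for \<mu>
    using that * unfolding c'_def
    by (auto intro!: subspace_add subspace_scale subspace_root_space)
  ultimately show ?case
    using * by (intro exI[of _ "insert \<rho> F"] exI[of _ c']) auto
qed

text \<open>Induction on \<open>F\<close>: a joint eigenspace of \<open>F\<close> is stable under
  any \<open>x\<close> commuting with \<open>F\<close>, hence contains the
  \<open>x\<close>-eigencomponents of its vectors.\<close>

lemma simultaneous_diagonalization:
  assumes "finite F" "\<And>x y. x \<in> F \<Longrightarrow> y \<in> F \<Longrightarrow> lie x y = 0" "\<And>x. x \<in> F \<Longrightarrow> ad_diagonalizable x"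
  shows "span (\<Union>\<rho>. root_space F \<rho>) = UNIV"
  using assms
proof (induction F rule: finite_induct)
  case empty
  have "(\<Union>\<rho>. root_space {} \<rho>) = UNIV" by (auto simp: root_space_def)
  then show ?case by simp
next
  case (insert x F)
  have "v \<in> span (\<Union>\<rho>. root_space (insert x F) \<rho>)" if v: "v \<in> root_space F \<rho>" for v \<rho>
  proof -
    \<comment> \<open>The eigenvalues of the single operator \<open>x\<close> are encoded as
      constant functions, which differ at \<open>x\<close> as soon as they are distinct.\<close>
    let ?L = "range (\<lambda>(c::complex) (_::'g). c)"
    have "{v. \<exists>c. lie x v = scale c v} = (\<Union>\<rho>\<in>?L. root_space {x} \<rho>)"
      by (auto simp: root_space_def)
    then have "v \<in> span (\<Union>\<rho>\<in>?L. root_space {x} \<rho>)"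
      using insert.prems(2)[of x] by (simp add: ad_diagonalizable_def)
    then obtain G c where G: "finite G" "G \<subseteq> ?L" "\<forall>\<rho>\<in>G. c \<rho> \<in> root_space {x} \<rho>" "v = sum c G"
      using span_weight_decomp by metis
    have "c \<mu> \<in> span (\<Union>\<rho>. root_space (insert x F) \<rho>)" if "\<mu> \<in> G" for \<mu>
    proof -
      have "c \<mu> \<in> root_space F \<rho>"
      proof (rule weight_components_mem[where F=G and H="{x}"])
        show "lie y u \<in> root_space F \<rho>" if "y \<in> {x}" "u \<in> root_space F \<rho>" for y u
          using that insert.prems(1)
          by (auto simp: root_space_def lie_leibniz[of _ x u] lie_scale_right)
        show "\<exists>y\<in>{x}. \<rho> y \<noteq> \<mu> y" if "\<rho> \<in> G" "\<mu> \<in> G" "\<rho> \<noteq> \<mu>" for \<rho> \<mu>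
          using that G(2) by auto
      qed (use G v that subspace_root_space in auto)
      \<comment> \<open>As \<open>x\<close> is not in \<open>F\<close>, changing \<rho> at
        \<open>x\<close> leaves the conditions for \<open>F\<close> alone.\<close>
      then have "c \<mu> \<in> root_space (insert x F) (\<rho>(x := \<mu> x))"
        using G(3) that insert.hyps by (auto simp: root_space_def)
      then show ?thesis by (intro span_base) auto
    qed
    then show ?thesis unfolding G(4) by (rule span_sum)
  qed
  then have "span (\<Union>\<rho>. root_space F \<rho>) \<subseteq> span (\<Union>\<rho>. root_space (insert x F) \<rho>)"
    by (intro span_minimal) auto
  then show ?case using insert by auto
qed

lemma finite_independent: "independent B \<Longrightarrow> finite B"
  using finite_dimensional independent_span_bound[of _ B] by auto

lemma finite_basis_subspace: "subspace S \<Longrightarrow> \<exists>B. finite B \<and> B \<subseteq> S \<and> independent B \<and> span B = S"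
  using maximal_independent_subset[of S] by (metis finite_independent span_subspace)

lemma dual_space_eqI:
  "\<rho> \<in> dual_space H \<Longrightarrow> \<mu> \<in> dual_space H \<Longrightarrow> (\<And>y. y \<in> H \<Longrightarrow> \<rho> y = \<mu> y) \<Longrightarrow> \<rho> = \<mu>"
  unfolding dual_space_def by (intro ext) (metis (mono_tags, lifting) mem_Collect_eq)

text \<open>For \<open>v\<close> non-zero the eigenvalue of each \<open>y\<close> in
  \<open>H\<close> is unique, hence linear in \<open>y\<close>; setting it to zero outside
  \<open>H\<close> gives an element of \<open>dual_space H\<close>.\<close>

lemma joint_eigenvector_root_space:
  assumes "subspace H" "span B = H" "v \<in> root_space B \<rho>"
  shows "\<exists>\<mu>\<in>dual_space H. v \<in> root_space H \<mu>"
proof (cases "v = 0")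
  case True
  then show ?thesis by (intro bexI[of _ "\<lambda>_. 0"]) (auto simp: root_space_def dual_space_def)
next
  case False
  have ex: "\<exists>c. lie y v = scale c v" if "y \<in> H" for y
    using that[folded assms(2)]
  proof (induction rule: span_induct_alt)
    case base then show ?case by (intro exI[of _ 0]) auto
  next
    case (step k a y)
    then obtain c where "lie y v = scale c v" by auto
    then have "lie (scale k a + y) v = scale (k * \<rho> a + c) v"
      using assms(3) step(1) by (auto simp: lie_add_left lie_scale_left root_space_def scale_left_distrib)
    then show ?case by blast
  qed
  define \<mu> where "\<mu> y = (if y \<in> H then THE c. lie y v = scale c v else 0)" for y
  have \<mu>: "\<mu> y = c" if "y \<in> H" "lie y v = scale c v" for y c
    using that False unfolding \<mu>_def by (auto intro!: the_equality)
  have \<mu>': "lie y v = scale (\<mu> y) v" if "y \<in> H" for y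
    using ex[OF that] \<mu>[OF that] by metis
  have "\<mu> \<in> dual_space H"
    unfolding dual_space_def
  proof (intro CollectI conjI ballI allI impI)
    fix x y assume "x \<in> H" "y \<in> H"
    then show "\<mu> (x + y) = \<mu> x + \<mu> y"
      using assms(1) by (intro \<mu>) (auto simp: subspace_add lie_add_left \<mu>' scale_left_distrib)
  next
    fix c x assume "x \<in> H"
    then show "\<mu> (scale c x) = c * \<mu> x"
      using assms(1) by (intro \<mu>) (auto simp: subspace_scale lie_scale_left \<mu>')
  qed (simp add: \<mu>_def)
  moreover have "v \<in> root_space H \<mu>" by (auto simp: root_space_def \<mu>')
  ultimately show ?thesis by blast
qed

lemma toral_decomposition:
  assumes "subspace H" "abelian H" "\<And>x. x \<in> H \<Longrightarrow> ad_diagonalizable x"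
  shows "span (\<Union>\<rho>\<in>dual_space H. root_space H \<rho>) = UNIV"
proof -
  obtain B where B: "finite B" "B \<subseteq> H" "span B = H"
    using finite_basis_subspace[OF assms(1)] by blast
  have "span (\<Union>\<rho>. root_space B \<rho>) = UNIV"
    using B assms by (intro simultaneous_diagonalization) (auto simp: abelian_def)
  moreover have "(\<Union>\<rho>. root_space B \<rho>) \<subseteq> (\<Union>\<rho>\<in>dual_space H. root_space H \<rho>)"
    using joint_eigenvector_root_space[OF assms(1) B(3)] by blast
  ultimately show ?thesis using span_mono by blast
qed

end

section \<open>Trace and Killing form\<close>

context lie_algebra
begin

text \<open>Both sides are the same double sum of products of matrix entries. With \<open>g\<close>
  the identity this is independence of the trace from the basis; with \<open>B = C\<close> it is
  cyclicity.\<close>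

lemma sum_representation_trace:
  assumes B: "independent B" "span B = UNIV" and C: "independent C" "span C = UNIV"
    and f: "Vector_Spaces.linear scale scale f" and g: "Vector_Spaces.linear scale scale g"
  shows "(\<Sum>b\<in>B. representation B (f (g b)) b) = (\<Sum>c\<in>C. representation C (g (f c)) c)"
proof -
  have expand: "representation D (h v) d = (\<Sum>e\<in>E. representation E v e * representation D (h e) d)"
    if D: "independent D" "span D = UNIV" and E: "independent E" "span E = UNIV"
      and h: "Vector_Spaces.linear scale scale h" for D E h v d
  proof -
    have hs: "h (\<Sum>i\<in>A. scale (k i) i) = (\<Sum>i\<in>A. scale (k i) (h i))" if "finite A" for A k
      using that h
    proof (induction A rule: finite_induct)
      case empty
      have "h (scale 0 0) = scale 0 (h 0)" using h unfolding Vector_Spaces.linear_iff by blast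
      then show ?case by simp
    qed (auto simp: Vector_Spaces.linear_iff)
    have "v = (\<Sum>e\<in>E. scale (representation E v e) e)"
      using E finite_independent by (subst sum_representation_eq) auto
    then have "h v = (\<Sum>e\<in>E. scale (representation E v e) (h e))"
      using hs[OF finite_independent[OF E(1)]] by metis
    then have "representation D (h v) d
        = representation D (\<Sum>e\<in>E. scale (representation E v e) (h e)) d" by (rule arg_cong)
    then show ?thesis
      unfolding representation_sum[OF D(1), of E "\<lambda>e. scale (representation E v e) (h e)", unfolded D(2), OF UNIV_I]
      using D by (simp add: representation_scale)
  qed
  have "(\<Sum>b\<in>B. representation B (f (g b)) b)
      = (\<Sum>b\<in>B. \<Sum>c\<in>C. representation C (g b) c * representation B (f c) b)"
    by (intro sum.cong refl expand B C f)
  also have "\<dots> = (\<Sum>c\<in>C. \<Sum>b\<in>B. representation B (f c) b * representation C (g b) c)"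
    by (subst sum.swap) (simp add: mult.commute)
  also have "\<dots> = (\<Sum>c\<in>C. representation C (g (f c)) c)"
    by (intro sum.cong refl expand[symmetric] B C g)
  finally show ?thesis .
qed

lemma basis_extend_basis: "independent (extend_basis {})" "span (extend_basis {}) = UNIV"
  using independent_extend_basis[OF independent_empty] span_extend_basis[OF independent_empty] by auto

lemma linear_lie: "Vector_Spaces.linear scale scale (lie x)"
  by (rule linear_right)

lemma linear_compose_lie: "Vector_Spaces.linear scale scale f \<Longrightarrow> Vector_Spaces.linear scale scale (\<lambda>z. lie x (f z))"
  by (auto simp: Vector_Spaces.linear_iff lie_add_right lie_scale_right)

lemma trace_eq_sum:
  assumes "independent C" "span C = UNIV" "Vector_Spaces.linear scale scale f"
  shows "trace f = (\<Sum>c\<in>C. representation C (f c) c)"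
proof -
  have "Vector_Spaces.linear scale scale (\<lambda>x. x)"
    using vector_space_axioms by (auto simp: Vector_Spaces.linear_iff)
  from sum_representation_trace[OF basis_extend_basis assms(1,2,3) this]
  show ?thesis by (simp add: trace_def)
qed

lemma trace_commute:
  assumes "Vector_Spaces.linear scale scale f" "Vector_Spaces.linear scale scale g"
  shows "trace (\<lambda>x. f (g x)) = trace (\<lambda>x. g (f x))"
  unfolding trace_def using assms by (intro sum_representation_trace basis_extend_basis)

lemma trace_add: "trace (\<lambda>x. f x + g x) = trace f + trace g"
  using basis_extend_basis by (simp add: trace_def representation_add sum.distrib)

lemma trace_diff: "trace (\<lambda>x. f x - g x) = trace f - trace g"
  using basis_extend_basis by (simp add: trace_def representation_diff sum_subtractf)

lemma trace_scale: "trace (\<lambda>x. scale k (f x)) = k * trace f"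
  using basis_extend_basis by (simp add: trace_def representation_scale sum_distrib_left)

lemma killing_commute: "killing x y = killing y x"
  unfolding killing_def by (rule trace_commute[OF linear_lie linear_lie])

lemma killing_add_left: "killing (x + y) z = killing x z + killing y z"
  by (simp add: killing_def lie_add_left trace_add)

lemma killing_scale_left: "killing (scale k x) z = k * killing x z"
  by (simp add: killing_def lie_scale_left trace_scale)

lemma killing_add_right: "killing z (x + y) = killing z x + killing z y"
  by (metis killing_commute killing_add_left)

lemma killing_scale_right: "killing z (scale k x) = k * killing z x"
  by (metis killing_commute killing_scale_left)

lemma killing_zero [simp]: "killing 0 x = 0" "killing x 0 = 0"
  using killing_scale_left[of 0 0 x] killing_scale_right[of x 0 0] by auto

lemma killing_diff_left: "killing (x - y) z = killing x z - killing y z"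
  using killing_add_left[of "x - y" y z] by simp

lemma killing_sum_left: "killing (sum f A) z = (\<Sum>i\<in>A. killing (f i) z)"
  by (induction A rule: infinite_finite_induct) (auto simp: killing_add_left)

lemma killing_sum_right: "killing z (sum f A) = (\<Sum>i\<in>A. killing z (f i))"
  by (induction A rule: infinite_finite_induct) (auto simp: killing_add_right)

text \<open>The operator of \<open>lie x y\<close> is a commutator, and the trace is cyclic.\<close>

lemma killing_invariant: "killing (lie x y) z = killing x (lie y z)"
proof -
  have "trace (\<lambda>v. lie y (lie x (lie z v))) = trace (\<lambda>v. lie x (lie z (lie y v)))"
    by (rule trace_commute) (intro linear_lie linear_compose_lie)+
  then show ?thesis
    by (simp add: killing_def lie_lie_left lie_diff_right trace_diff)
qed

end

section \<open>Integer multiples of weights\<close>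

definition zmul :: "int \<Rightarrow> ('a \<Rightarrow> complex) \<Rightarrow> ('a \<Rightarrow> complex)" where
  "zmul m f = (\<lambda>x. of_int m * f x)"

lemma zmul_apply [simp]: "zmul m f x = of_int m * f x"
  by (simp add: zmul_def)

lemma zmul_0 [simp]: "zmul 0 f = 0"
  and zmul_1 [simp]: "zmul 1 f = f"
  and zmul_add: "zmul (m + n) f = zmul m f + zmul n f"
  and zmul_minus: "zmul (- m) f = - zmul m f"
  and zmul_uminus_right: "zmul m (- f) = - zmul m f"
  and zmul_diff: "zmul (m - n) f = zmul m f - zmul n f"
  by (auto simp: fun_eq_iff algebra_simps)

context lie_algebra
begin

lemma dual_space_0 [simp]: "0 \<in> dual_space H"
  and dual_space_add: "\<alpha> \<in> dual_space H \<Longrightarrow> \<beta> \<in> dual_space H \<Longrightarrow> \<alpha> + \<beta> \<in> dual_space H"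
  and dual_space_minus: "\<alpha> \<in> dual_space H \<Longrightarrow> - \<alpha> \<in> dual_space H"
  and dual_space_zmul: "\<alpha> \<in> dual_space H \<Longrightarrow> zmul m \<alpha> \<in> dual_space H"
  by (auto simp: dual_space_def algebra_simps)

end

section \<open>Weights and a basis of weight vectors\<close>

locale simple_cartan = lie_algebra scale lie
  for scale :: "complex \<Rightarrow> 'g::ab_group_add \<Rightarrow> 'g" and lie :: "'g \<Rightarrow> 'g \<Rightarrow> 'g" +
  fixes \<hh> :: "'g set"
  assumes simple_algebra: simple
    and cartan: "cartan_subalgebra \<hh>"
begin

abbreviation "gs \<equiv> root_space \<hh>"
abbreviation "dual \<equiv> dual_space \<hh>"

lemma subspace_cartan: "subspace \<hh>"
  and lie_cartan: "x \<in> \<hh> \<Longrightarrow> y \<in> \<hh> \<Longrightarrow> lie x y = 0"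
  and diagonalizable_cartan: "x \<in> \<hh> \<Longrightarrow> ad_diagonalizable x"
  and abelian_cartan: "abelian \<hh>"
  using cartan by (auto simp: cartan_subalgebra_def subalgebra_def abelian_def)

lemma root_space_0: "gs 0 = \<hh>"
proof -
  have "gs 0 = {x. \<forall>y\<in>\<hh>. lie x y = 0}"
    by (auto simp: root_space_def) (metis lie_anticomm neg_equal_0_iff_equal)+
  then show ?thesis using cartan by (simp add: cartan_subalgebra_def)
qed

lemma ideal_trivial: "ideal I UNIV \<Longrightarrow> I = {0} \<or> I = UNIV"
  and not_abelian: "\<exists>x y. lie x y \<noteq> 0"
  using simple_algebra by (auto simp: simple_def abelian_def)

text \<open>The center is an ideal and is not everything, so simplicity makes it zero.\<close>

lemma central_zero:
  assumes "\<And>y. lie x y = 0"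
  shows "x = 0"
proof -
  let ?Z = "{x. \<forall>y. lie x y = 0}"
  have "subspace ?Z" by (rule subspaceI) (auto simp: lie_add_left lie_scale_left)
  then have "ideal ?Z UNIV"
    by (auto simp: ideal_def bracket_subset_iff lie_lie_left)
  then have "?Z = {0}" using ideal_trivial not_abelian by blast
  then show ?thesis using assms by blast
qed

text \<open>In a basis of weight vectors the elements of \<hh> act diagonally, and traces become
  sums over weights with multiplicity.\<close>

definition wbasis :: "'g set" where
  "wbasis = (SOME C. C \<subseteq> (\<Union>\<rho>\<in>dual. gs \<rho>) \<and> independent C \<and> span C = UNIV)"

lemma wbasis: "wbasis \<subseteq> (\<Union>\<rho>\<in>dual. gs \<rho>)" "independent wbasis" "span wbasis = UNIV"
proof -
  let ?V = "\<Union>\<rho>\<in>dual. gs \<rho>"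
  obtain C where C: "C \<subseteq> ?V" "independent C" "?V \<subseteq> span C"
    using maximal_independent_subset by metis
  have "span ?V = UNIV"
    by (intro toral_decomposition subspace_cartan abelian_cartan diagonalizable_cartan)
  moreover have "span ?V \<subseteq> span C" using C(3) by (intro span_minimal) auto
  ultimately have "span C = UNIV" by auto
  then have "C \<subseteq> ?V \<and> independent C \<and> span C = UNIV" using C by blast
  then have "wbasis \<subseteq> ?V \<and> independent wbasis \<and> span wbasis = UNIV"
    unfolding wbasis_def by (rule someI)
  then show "wbasis \<subseteq> ?V" "independent wbasis" "span wbasis = UNIV" by auto
qed

lemma finite_wbasis [simp]: "finite wbasis"
  using wbasis(2) by (rule finite_independent)

lemma wbasis_nonzero: "c \<in> wbasis \<Longrightarrow> c \<noteq> 0"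
  using wbasis(2) dependent_zero by blast

definition wt :: "'g \<Rightarrow> 'g \<Rightarrow> complex" where
  "wt c = (SOME \<rho>. \<rho> \<in> dual \<and> c \<in> gs \<rho>)"

lemma wt: assumes "c \<in> wbasis" shows "wt c \<in> dual" "c \<in> gs (wt c)"
proof -
  have "\<exists>\<rho>. \<rho> \<in> dual \<and> c \<in> gs \<rho>" using wbasis(1) assms by auto
  then have "wt c \<in> dual \<and> c \<in> gs (wt c)" unfolding wt_def by (rule someI_ex)
  then show "wt c \<in> dual" "c \<in> gs (wt c)" by auto
qed

definition coord :: "'g \<Rightarrow> 'g \<Rightarrow> complex" where
  "coord c v = representation wbasis v c"

lemma coord_add: "coord c (x + y) = coord c x + coord c y"
  and coord_diff: "coord c (x - y) = coord c x - coord c y"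
  and coord_scale: "coord c (scale k x) = k * coord c x"
  and coord_zero [simp]: "coord c 0 = 0"
  using wbasis unfolding coord_def
  by (simp_all add: representation_add representation_diff representation_scale representation_zero)

lemma coord_sum: "coord c (sum f A) = (\<Sum>i\<in>A. coord c (f i))"
  by (induction A rule: infinite_finite_induct) (auto simp: coord_add)

lemma coord_basis: "c' \<in> wbasis \<Longrightarrow> coord c c' = (if c = c' then 1 else 0)"
  using wbasis unfolding coord_def by (simp add: representation_basis)

lemma coord_expand: "(\<Sum>c\<in>wbasis. scale (coord c v) c) = v"
  using wbasis unfolding coord_def by (intro sum_representation_eq) auto

lemma coord_lie:
  assumes "y \<in> \<hh>" "c \<in> wbasis"
  shows "coord c (lie y v) = wt c y * coord c v"
proof -
  have "lie y v = (\<Sum>d\<in>wbasis. scale (coord d v) (lie y d))"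
    by (subst (1) coord_expand[symmetric, of v]) (simp add: lie_sum_right lie_scale_right)
  also have "\<dots> = (\<Sum>d\<in>wbasis. scale (coord d v * wt d y) d)"
    using assms wt by (intro sum.cong) (auto simp: root_space_def)
  finally have "coord c (lie y v) = (\<Sum>d\<in>wbasis. coord d v * wt d y * (if c = d then 1 else 0))"
    by (simp add: coord_sum coord_scale coord_basis)
  also have "\<dots> = coord c v * wt c y"
    using assms(2) by (subst sum.remove[of _ c]) (auto intro!: sum.neutral split: if_splits)
  finally show ?thesis by simp
qed

text \<open>Compare the coordinates at \<open>c\<close> on both sides of
  \<open>lie y v = scale (\<mu> y) v\<close> and cancel the non-zero one.\<close>

lemma coord_weight:
  assumes "v \<in> gs \<mu>" "\<mu> \<in> dual" "c \<in> wbasis" "coord c v \<noteq> 0"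
  shows "wt c = \<mu>"
proof (rule dual_space_eqI[OF wt(1)[OF assms(3)] assms(2)])
  fix y assume y: "y \<in> \<hh>"
  then have "lie y v = scale (\<mu> y) v" using assms(1) by (auto simp: root_space_def)
  then have "wt c y * coord c v = \<mu> y * coord c v"
    using coord_lie[OF y assms(3), of v] by (metis coord_scale)
  then show "wt c y = \<mu> y" using assms(4) by (metis mult_cancel_right)
qed

text \<open>Zero is included (\<open>zero_weight\<close>), so strings passing through zero are
  treated uniformly.\<close>

definition weights :: "('g \<Rightarrow> complex) set" where
  "weights = wt ` wbasis"

lemma finite_weights [simp]: "finite weights"
  by (simp add: weights_def)

lemma weights_dual: "\<mu> \<in> weights \<Longrightarrow> \<mu> \<in> dual"
  using wt(1) by (auto simp: weights_def)

lemma weightI: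
  assumes "v \<in> gs \<mu>" "\<mu> \<in> dual" "v \<noteq> 0"
  shows "\<mu> \<in> weights"
proof -
  have "\<exists>c\<in>wbasis. coord c v \<noteq> 0"
  proof (rule ccontr)
    assume "\<not> ?thesis"
    then have "(\<Sum>c\<in>wbasis. scale (coord c v) c) = 0" by (intro sum.neutral) auto
    then show False using assms(3) by (simp add: coord_expand)
  qed
  then show ?thesis using coord_weight[OF assms(1,2)] by (auto simp: weights_def)
qed

lemma weightE: assumes "\<mu> \<in> weights" obtains c where "c \<in> wbasis" "wt c = \<mu>" "c \<in> gs \<mu>" "c \<noteq> 0"
  using assms wt wbasis_nonzero by (auto simp: weights_def)

text \<open>If only the zero operator had to be tested, the weight space of zero would be the whole
  algebra; but it equals \<hh>.\<close>

lemma cartan_nonzero: "\<hh> \<noteq> {0}"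
proof
  assume "\<hh> = {0}"
  then have "gs 0 = UNIV" by (auto simp: root_space_def)
  then show False using root_space_0 \<open>\<hh> = {0}\<close> not_abelian by (metis UNIV_I lie_zero_left singletonD)
qed

lemma zero_weight: "0 \<in> weights"
proof -
  obtain v where "v \<in> \<hh>" "v \<noteq> 0"
    using cartan_nonzero subspace_cartan subspace_0 by blast
  then show ?thesis using root_space_0 by (intro weightI[of v]) auto
qed

abbreviation "\<Delta> \<equiv> roots \<hh>"

lemma roots_eq: "\<Delta> = weights - {0}"
proof -
  have "gs \<mu> \<noteq> {0} \<longleftrightarrow> \<mu> \<in> weights" if "\<mu> \<in> dual" for \<mu>
    using weightI[OF _ that] weightE[of \<mu>] subspace_0[OF subspace_root_space] by blast
  then show ?thesis using weights_dual by (auto simp: roots_def zero_fun_def)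
qed

lemma finite_roots [simp]: "finite \<Delta>"
  and zero_notin_roots [simp]: "0 \<notin> \<Delta>"
  and roots_weights: "\<alpha> \<in> \<Delta> \<Longrightarrow> \<alpha> \<in> weights"
  and roots_dual: "\<alpha> \<in> \<Delta> \<Longrightarrow> \<alpha> \<in> dual"
  and weights_cases: "\<mu> \<in> weights \<Longrightarrow> \<mu> = 0 \<or> \<mu> \<in> \<Delta>"
  using weights_dual by (auto simp: roots_eq)

definition wproj :: "('g \<Rightarrow> complex) \<Rightarrow> 'g \<Rightarrow> 'g" where
  "wproj \<mu> v = (\<Sum>c | c \<in> wbasis \<and> wt c = \<mu>. scale (coord c v) c)"

lemma wproj_root_space: "wproj \<mu> v \<in> gs \<mu>"
  unfolding wproj_def
  by (intro subspace_sum subspace_scale subspace_root_space) (use wt in auto)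

lemma sum_wproj: "(\<Sum>\<mu>\<in>weights. wproj \<mu> v) = v"
proof -
  have "(\<Sum>\<mu>\<in>weights. wproj \<mu> v) = (\<Sum>c\<in>wbasis. scale (coord c v) c)"
    unfolding wproj_def weights_def by (rule sum.group) auto
  then show ?thesis by (simp add: coord_expand)
qed

definition hstable :: "'g set \<Rightarrow> bool" where
  "hstable U \<longleftrightarrow> subspace U \<and> (\<forall>y\<in>\<hh>. \<forall>u\<in>U. lie y u \<in> U)"

lemma wproj_mem:
  assumes "hstable U" "v \<in> U" "\<mu> \<in> weights"
  shows "wproj \<mu> v \<in> U"
proof (rule weight_components_mem[where F=weights and H=\<hh>])
  show "\<exists>y\<in>\<hh>. \<rho> y \<noteq> \<mu> y" if "\<rho> \<in> weights" "\<mu> \<in> weights" "\<rho> \<noteq> \<mu>" for \<rho> \<mu>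
    using dual_space_eqI[of \<rho> \<hh> \<mu>] that weights_dual by blast
qed (use assms in \<open>auto simp: sum_wproj wproj_root_space hstable_def\<close>)

text \<open>By \<open>wproj_mem\<close> the weight components of a vector of \<open>U\<close> stay
  in \<open>U\<close>.\<close>

lemma hstable_eq_span:
  assumes "hstable U"
  shows "U = span (\<Union>\<mu>\<in>weights. U \<inter> gs \<mu>)"
proof
  show "U \<subseteq> span (\<Union>\<mu>\<in>weights. U \<inter> gs \<mu>)"
  proof
    fix v assume v: "v \<in> U"
    have "(\<Sum>\<mu>\<in>weights. wproj \<mu> v) \<in> span (\<Union>\<mu>\<in>weights. U \<inter> gs \<mu>)"
      using wproj_mem[OF assms v] wproj_root_space by (intro span_sum span_base) blast
    then show "v \<in> span (\<Union>\<mu>\<in>weights. U \<inter> gs \<mu>)" by (simp add: sum_wproj)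
  qed
  show "span (\<Union>\<mu>\<in>weights. U \<inter> gs \<mu>) \<subseteq> U"
    using assms by (intro span_minimal) (auto simp: hstable_def)
qed

text \<open>Moving \<open>v\<close> to the other side gives a vanishing sum of vectors of distinct
  weights; \<open>weight_components_mem\<close> for the zero subspace kills every component.\<close>

lemma root_space_span_disjoint:
  assumes "v \<in> gs \<alpha>" "v \<in> span (\<Union>\<beta>\<in>T. gs \<beta>)" "T \<subseteq> weights" "\<alpha> \<in> weights" "\<alpha> \<notin> T"
  shows "v = 0"
proof -
  obtain F c where F: "finite F" "F \<subseteq> T" "\<forall>\<beta>\<in>F. c \<beta> \<in> gs \<beta>" "v = sum c F"
    using span_weight_decomp[OF assms(2)] by blast
  define c' where "c' = c(\<alpha> := - v)"
  have \<alpha>: "\<alpha> \<notin> F" using F(2) assms(5) by blast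
  then have "sum c' F = sum c F" by (intro sum.cong) (auto simp: c'_def)
  then have 0: "sum c' (insert \<alpha> F) = 0" using F \<alpha> by (simp add: c'_def)
  have "c' \<alpha> \<in> {0}"
  proof (rule weight_components_mem[where F="insert \<alpha> F" and H=\<hh>])
    show "c' \<beta> \<in> gs \<beta>" if "\<beta> \<in> insert \<alpha> F" for \<beta>
      using that F(3) subspace_neg[OF subspace_root_space assms(1)] by (auto simp: c'_def)
    show "\<exists>y\<in>\<hh>. \<rho> y \<noteq> \<mu> y" if "\<rho> \<in> insert \<alpha> F" "\<mu> \<in> insert \<alpha> F" "\<rho> \<noteq> \<mu>" for \<rho> \<mu>
    proof -
      have "\<rho> \<in> weights" "\<mu> \<in> weights" using that F(2) assms(3,4) by blast+
      then show ?thesis using dual_space_eqI[of \<rho> \<hh> \<mu>] that(3) weights_dual by blast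
    qed
  qed (use F 0 in auto)
  then show ?thesis by (simp add: c'_def)
qed

lemma span_weight_spaces: "span (\<Union>\<mu>\<in>weights. gs \<mu>) = UNIV"
  using hstable_eq_span[of UNIV] by (simp add: hstable_def)

lemma killing_eq_sum: "killing x y = (\<Sum>c\<in>wbasis. coord c (lie x (lie y c)))"
  unfolding killing_def coord_def
  by (intro trace_eq_sum wbasis linear_compose_lie linear_lie)

lemma killing_cartan:
  assumes "x \<in> \<hh>" "y \<in> \<hh>"
  shows "killing x y = (\<Sum>c\<in>wbasis. wt c x * wt c y)"
  unfolding killing_eq_sum using assms by (intro sum.cong) (auto simp: coord_lie coord_basis)

text \<open>The composite operator shifts weights by \<open>\<alpha> + \<beta>\<close>, so its
  diagonal entries in \<open>wbasis\<close> vanish.\<close>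

lemma killing_orthogonal:
  assumes "x \<in> gs \<alpha>" "y \<in> gs \<beta>" "\<alpha> \<in> dual" "\<beta> \<in> dual" "\<alpha> + \<beta> \<noteq> 0"
  shows "killing x y = 0"
  unfolding killing_eq_sum
proof (rule sum.neutral, rule ballI, rule ccontr)
  fix c assume c: "c \<in> wbasis" and nz: "coord c (lie x (lie y c)) \<noteq> 0"
  have "lie x (lie y c) \<in> gs (\<alpha> + (\<beta> + wt c))"
    using assms c wt by (intro root_space_lie) auto
  from coord_weight[OF this _ c nz] have "wt c = \<alpha> + (\<beta> + wt c)"
    using assms c wt by (auto intro!: dual_space_add)
  then show False using assms(5) by (auto simp: fun_eq_iff)
qed

end

section \<open>Nondegeneracy and root vectors\<close>

context simple_cartan
begin

section \<open>Brackets of opposite root vectors and nondegeneracy\<close>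

lemma coord_lie_lie:
  "coord c (lie x (lie y v)) = (\<Sum>d\<in>wbasis. coord d (lie y v) * coord c (lie x d))"
proof -
  have "lie x (lie y v) = lie x (\<Sum>d\<in>wbasis. scale (coord d (lie y v)) d)"
    by (simp add: coord_expand)
  also have "\<dots> = (\<Sum>d\<in>wbasis. scale (coord d (lie y v)) (lie x d))"
    by (simp only: lie_sum_right lie_scale_right)
  finally show ?thesis by (simp only: coord_sum coord_scale)
qed

lemma lie_opposite_mem: "x \<in> gs \<alpha> \<Longrightarrow> y \<in> gs (- \<alpha>) \<Longrightarrow> lie x y \<in> \<hh>"
  using root_space_lie[of x \<hh> \<alpha> y "- \<alpha>"] by (simp add: root_space_0)

text \<open>A commutator has trace zero on the sum of the weight spaces along an \<open>\<alpha>\<close>-string.\<close>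

lemma string_trace:
  assumes x: "x \<in> gs \<alpha>" and y: "y \<in> gs (- \<alpha>)" and \<alpha>: "\<alpha> \<in> dual"
  shows "(\<Sum>c | c \<in> wbasis \<and> (\<exists>k. wt c = \<beta> + zmul k \<alpha>). wt c (lie x y)) = 0"
proof -
  define K where "K = {c \<in> wbasis. \<exists>k. wt c = \<beta> + zmul k \<alpha>}"
  have K: "finite K" "K \<subseteq> wbasis" by (auto simp: K_def)
  have res: "(\<Sum>c\<in>K. coord c (lie u (lie v c)))
      = (\<Sum>c\<in>K. \<Sum>d\<in>K. coord d (lie v c) * coord c (lie u d))"
    if v: "v \<in> gs (zmul m \<alpha>)" for u v m
  proof (rule sum.cong[OF refl])
    fix c assume c: "c \<in> K"
    \<comment> \<open>\<open>lie v\<close> moves weights along the string only, so the matrix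
      product may be restricted to \<open>K\<close>.\<close>
    have "d \<in> K" if d: "d \<in> wbasis" "coord d (lie v c) \<noteq> 0" for d
    proof -
      obtain k where k: "c \<in> wbasis" "wt c = \<beta> + zmul k \<alpha>" using c by (auto simp: K_def)
      have "lie v c \<in> gs (zmul m \<alpha> + wt c)" using v wt(2)[OF k(1)] by (rule root_space_lie)
      moreover have "zmul m \<alpha> + wt c \<in> dual"
        using \<alpha> wt(1)[OF k(1)] by (intro dual_space_add dual_space_zmul)
      ultimately have "wt d = zmul m \<alpha> + wt c"
        using d coord_weight by blast
      then have "wt d = \<beta> + zmul (m + k) \<alpha>" by (simp add: k zmul_add add_ac)
      then show ?thesis using d by (auto simp: K_def)
    qed
    then show "coord c (lie u (lie v c)) = (\<Sum>d\<in>K. coord d (lie v c) * coord c (lie u d))"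
      unfolding coord_lie_lie using K by (intro sum.mono_neutral_right) auto
  qed
  have t: "lie x y \<in> \<hh>" using x y by (rule lie_opposite_mem)
  have "(\<Sum>c\<in>K. wt c (lie x y)) = (\<Sum>c\<in>K. coord c (lie (lie x y) c))"
    using t K by (intro sum.cong) (auto simp: coord_lie coord_basis)
  also have "\<dots> = (\<Sum>c\<in>K. coord c (lie x (lie y c))) - (\<Sum>c\<in>K. coord c (lie y (lie x c)))"
    by (simp add: lie_lie_left coord_diff sum_subtractf)
  also have "(\<Sum>c\<in>K. coord c (lie x (lie y c))) = (\<Sum>c\<in>K. \<Sum>d\<in>K. coord d (lie y c) * coord c (lie x d))"
    by (rule res[of _ "-1"]) (use y in \<open>simp add: zmul_minus\<close>)
  also have "(\<Sum>c\<in>K. coord c (lie y (lie x c))) = (\<Sum>c\<in>K. \<Sum>d\<in>K. coord d (lie x c) * coord c (lie y d))"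
    by (rule res[of _ 1]) (use x in simp)
  also have "\<dots> = (\<Sum>c\<in>K. \<Sum>d\<in>K. coord d (lie y c) * coord c (lie x d))"
    by (subst sum.swap) (simp add: mult.commute)
  finally show ?thesis by (simp add: K_def)
qed

text \<open>In \<open>string_trace\<close> every summand is \<beta> plus an integer multiple of
  \<alpha>; dividing by the number of summands expresses \<beta> at the bracket as a rational
  multiple of \<alpha> there.\<close>

lemma weight_real_multiple:
  assumes x: "x \<in> gs \<alpha>" and y: "y \<in> gs (- \<alpha>)" and \<alpha>: "\<alpha> \<in> dual" and \<beta>: "\<beta> \<in> weights"
  shows "\<exists>q. \<beta> (lie x y) = of_real q * \<alpha> (lie x y)"
proof -
  define K where "K = {c \<in> wbasis. \<exists>k. wt c = \<beta> + zmul k \<alpha>}"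
  define k where "k c = (SOME k. wt c = \<beta> + zmul k \<alpha>)" for c
  have k: "wt c = \<beta> + zmul (k c) \<alpha>" if "c \<in> K" for c
    using that unfolding K_def k_def by (auto intro: someI_ex)
  obtain c where "c \<in> wbasis" "wt c = \<beta>" using \<beta> by (rule weightE)
  \<comment> \<open>The string contains \<beta> itself, so the later divisor is not zero.\<close>
  then have "c \<in> K" by (auto simp: K_def intro!: exI[of _ 0])
  moreover have "finite K" by (simp add: K_def)
  ultimately have card: "card K \<noteq> 0" by auto
  let ?t = "lie x y"
  have "0 = (\<Sum>c\<in>K. wt c ?t)" using string_trace[OF x y \<alpha>, of \<beta>] by (simp add: K_def)
  also have "\<dots> = (\<Sum>c\<in>K. \<beta> ?t + of_int (k c) * \<alpha> ?t)" by (rule sum.cong) (auto simp: k)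
  also have "\<dots> = of_nat (card K) * \<beta> ?t + of_int (\<Sum>c\<in>K. k c) * \<alpha> ?t"
    by (simp add: sum.distrib sum_distrib_right)
  finally have "of_nat (card K) * \<beta> ?t = - of_int (\<Sum>c\<in>K. k c) * \<alpha> ?t"
    by (simp add: eq_neg_iff_add_eq_0)
  then have "\<beta> ?t = of_real (- of_int (\<Sum>c\<in>K. k c) / of_nat (card K)) * \<alpha> ?t"
    using card by (simp add: field_simps)
  then show ?thesis by blast
qed

text \<open>Such an element acts as zero on every basis vector, hence is central.\<close>

lemma weights_separate:
  assumes "t \<in> \<hh>" "\<And>\<beta>. \<beta> \<in> weights \<Longrightarrow> \<beta> t = 0"
  shows "t = 0"
proof (rule central_zero)
  fix v
  have "coord c (lie t v) = 0" if "c \<in> wbasis" for c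
    using coord_lie[OF assms(1) that, of v] assms(2)[of "wt c"] that by (simp add: weights_def)
  then have "(\<Sum>c\<in>wbasis. scale (coord c (lie t v)) c) = 0" by (intro sum.neutral) auto
  then show "lie t v = 0" by (simp add: coord_expand)
qed

text \<open>All weights at \<open>t = lie x y\<close> are real multiples \<open>q\<close> of
  \<open>\<alpha> t\<close>. If that value were zero, all weights would vanish at \<open>t\<close>.
  The Killing square is its square times the sum of the squares of the \<open>q\<close>, one of
  which is 1.\<close>

lemma opposite_bracket_nonisotropic:
  assumes x: "x \<in> gs \<alpha>" and y: "y \<in> gs (- \<alpha>)" and \<alpha>: "\<alpha> \<in> weights" and nz: "lie x y \<noteq> 0"
  shows "\<alpha> (lie x y) \<noteq> 0" "killing (lie x y) (lie x y) \<noteq> 0"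
proof -
  let ?t = "lie x y"
  have t: "?t \<in> \<hh>" using x y by (rule lie_opposite_mem)
  have "\<forall>c\<in>wbasis. \<exists>q. wt c ?t = of_real q * \<alpha> ?t"
    using weight_real_multiple[OF x y weights_dual[OF \<alpha>]] by (auto simp: weights_def)
  then obtain q where q: "\<And>c. c \<in> wbasis \<Longrightarrow> wt c ?t = of_real (q c) * \<alpha> ?t" by metis
  show nz\<alpha>: "\<alpha> ?t \<noteq> 0"
  proof
    assume "\<alpha> ?t = 0"
    then have "?t = 0" using q by (intro weights_separate[OF t]) (auto simp: weights_def)
    with nz show False ..
  qed
  obtain c where c: "c \<in> wbasis" "wt c = \<alpha>" using \<alpha> by (rule weightE)
  have "(q c)\<^sup>2 \<le> (\<Sum>c\<in>wbasis. (q c)\<^sup>2)" using c by (intro member_le_sum) auto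
  moreover have "q c = 1" using q[OF c(1)] c(2) nz\<alpha> by simp
  ultimately have pos: "(\<Sum>c\<in>wbasis. (q c)\<^sup>2) \<noteq> 0" by auto
  have "killing ?t ?t = (\<Sum>c\<in>wbasis. of_real ((q c)\<^sup>2) * (\<alpha> ?t)\<^sup>2)"
    unfolding killing_cartan[OF t t] using q by (intro sum.cong) (auto simp: power2_eq_square)
  also have "\<dots> = of_real (\<Sum>c\<in>wbasis. (q c)\<^sup>2) * (\<alpha> ?t)\<^sup>2" by (simp add: sum_distrib_right)
  finally show "killing ?t ?t \<noteq> 0" using pos nz\<alpha> by (simp only: mult_eq_0_iff of_real_eq_0_iff) simp
qed

text \<open>
  If the Killing form vanished, then so would all brackets of opposite root spaces, and the sum of
  the root spaces would be an ideal.
\<close>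

lemma killing_nonzero: "\<exists>x y. killing x y \<noteq> 0"
proof (rule ccontr)
  assume "\<not> ?thesis"
  then have zero: "killing x y = 0" for x y by blast
  let ?U = "span (\<Union>\<alpha>\<in>\<Delta>. gs \<alpha>)"
  have mem: "lie x y \<in> ?U" if x: "x \<in> gs \<alpha>" "\<alpha> \<in> weights" and y: "y \<in> gs \<beta>" "\<beta> \<in> \<Delta>" for x y \<alpha> \<beta>
  proof (cases "lie x y = 0")
    case True then show ?thesis by (simp add: span_zero)
  next
    case False
    have "lie x y \<in> gs (\<alpha> + \<beta>)" using x y by (intro root_space_lie)
    then have "\<alpha> + \<beta> \<in> weights"
      using False weights_dual[OF x(2)] roots_dual[OF y(2)]
      by (intro weightI[of "lie x y"]) (auto intro: dual_space_add)
    moreover have "\<alpha> + \<beta> \<noteq> 0"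
    proof
      assume "\<alpha> + \<beta> = 0"
      then have "\<beta> = - \<alpha>" by (simp add: add_eq_0_iff)
      then show False
        using opposite_bracket_nonisotropic(2)[OF x(1) _ x(2) False] y zero by auto
    qed
    ultimately show ?thesis
      using \<open>lie x y \<in> gs (\<alpha> + \<beta>)\<close> weights_cases by (intro span_base) blast
  qed
  have "bracket (span (\<Union>\<alpha>\<in>weights. gs \<alpha>)) ?U \<subseteq> ?U"
    using mem by (intro bracket_span_subset) auto
  then have "ideal ?U UNIV" by (simp add: ideal_def span_weight_spaces)
  then consider "?U = {0}" | "?U = UNIV" using ideal_trivial by blast
  then show False
  proof cases
    case 1
    have "gs \<alpha> \<subseteq> \<hh>" if "\<alpha> \<in> weights" for \<alpha>
    proof (cases "\<alpha> = 0")
      case False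
      then have "gs \<alpha> \<subseteq> ?U" using that weights_cases by (intro order.trans[OF _ span_superset]) auto
      then show ?thesis using 1 subspace_0[OF subspace_cartan] by auto
    qed (simp add: root_space_0)
    then have "(\<Union>\<mu>\<in>weights. gs \<mu>) \<subseteq> \<hh>" by blast
    then have "UNIV \<subseteq> \<hh>"
      unfolding span_weight_spaces[symmetric] by (rule span_minimal[OF _ subspace_cartan])
    then show False using not_abelian lie_cartan by blast
  next
    case 2
    obtain v where v: "v \<in> \<hh>" "v \<noteq> 0" using cartan_nonzero subspace_0[OF subspace_cartan] by blast
    then show False
      using 2 root_space_span_disjoint[of v 0 \<Delta>] root_space_0 zero_weight roots_weights by auto
  qed
qed

text \<open>By invariance the radical is an ideal, and it is proper by
  \<open>killing_nonzero\<close>.\<close>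

lemma killing_nondegenerate:
  assumes "\<And>y. killing x y = 0"
  shows "x = 0"
proof -
  let ?R = "{x. \<forall>y. killing x y = 0}"
  have "subspace ?R" by (rule subspaceI) (auto simp: killing_add_left killing_scale_left)
  moreover have "killing (lie a b) y = 0" if "b \<in> ?R" for a b y
    using that killing_invariant[of b a y] lie_anticomm[of a b] killing_scale_left[of "-1" "lie b a" y]
    by simp
  ultimately have "ideal ?R UNIV" by (auto simp: ideal_def bracket_subset_iff)
  then have "?R = {0}" using ideal_trivial killing_nonzero by blast
  then show ?thesis using assms by blast
qed

text \<open>Some weight component of a vector not orthogonal to \<open>x\<close> is itself not
  orthogonal to \<open>x\<close>, and \<open>killing_orthogonal\<close> forces its weight to be
  \<open>- \<mu>\<close>.\<close>

lemma killing_pairing: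
  assumes "x \<in> gs \<mu>" "\<mu> \<in> weights" "x \<noteq> 0"
  shows "- \<mu> \<in> weights" "\<exists>y\<in>gs (- \<mu>). killing x y \<noteq> 0"
proof -
  obtain y where y: "killing x y \<noteq> 0" using killing_nondegenerate assms(3) by blast
  have "killing x y = (\<Sum>\<nu>\<in>weights. killing x (wproj \<nu> y))"
    by (subst sum_wproj[symmetric, of y]) (rule killing_sum_right)
  then obtain \<nu> where \<nu>: "\<nu> \<in> weights" "killing x (wproj \<nu> y) \<noteq> 0"
    using y by (metis (no_types, lifting) sum.neutral)
  then have "\<mu> + \<nu> = 0"
    using killing_orthogonal[OF assms(1) wproj_root_space] assms(2) weights_dual by blast
  then have "\<nu> = - \<mu>" by (simp add: add_eq_0_iff)
  then show "- \<mu> \<in> weights" "\<exists>y\<in>gs (- \<mu>). killing x y \<noteq> 0"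
    using \<nu> wproj_root_space[of \<nu> y] by auto
qed

lemma weights_uminus: "\<mu> \<in> weights \<Longrightarrow> - \<mu> \<in> weights"
  using killing_pairing(1) weightE by metis

lemma roots_uminus: "\<alpha> \<in> \<Delta> \<Longrightarrow> - \<alpha> \<in> \<Delta>"
  using weights_uminus by (auto simp: roots_eq)

lemma cartan_nondegenerate:
  assumes "x \<in> \<hh>" "\<And>y. y \<in> \<hh> \<Longrightarrow> killing x y = 0"
  shows "x = 0"
proof (rule ccontr)
  assume "x \<noteq> 0"
  then have "\<exists>y\<in>gs (- 0). killing x y \<noteq> 0"
    using assms(1) root_space_0 zero_weight by (intro killing_pairing) auto
  then show False using assms(2) root_space_0 by auto
qed

section \<open>Dual elements, coroots and sl2-triples\<close>

abbreviation "kd \<equiv> killing_dual \<hh>"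

lemma killing_dual_eqI:
  assumes "t \<in> \<hh>" "\<And>z. z \<in> \<hh> \<Longrightarrow> killing t z = \<alpha> z"
  shows "kd \<alpha> = t"
  unfolding killing_dual_def
proof (rule the_equality)
  fix u assume u: "u \<in> \<hh> \<and> (\<forall>z\<in>\<hh>. killing u z = \<alpha> z)"
  have "u - t = 0"
    by (rule cartan_nondegenerate)
      (use u assms in \<open>auto simp: killing_diff_left intro: subspace_diff[OF subspace_cartan]\<close>)
  then show "u = t" by simp
qed (use assms in auto)

lemma killing_opposite_bracket:
  assumes "x \<in> gs \<alpha>" "y \<in> gs (- \<alpha>)" "z \<in> \<hh>"
  shows "killing (lie x y) z = \<alpha> z * killing x y"
proof -
  have "lie y z = scale (\<alpha> z) y"
    using assms(2,3) lie_anticomm[of y z] by (simp add: root_space_def)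
  then show ?thesis by (simp add: killing_invariant killing_scale_right)
qed

text \<open>A bracket of opposite root vectors, divided by their Killing product, represents
  \<alpha>. This provides existence for the \<open>THE\<close> in \<open>killing_dual\<close>, and
  non-isotropy is inherited from the bracket.\<close>

lemma killing_dual_root:
  assumes \<alpha>: "\<alpha> \<in> \<Delta>"
  shows "kd \<alpha> \<in> \<hh>" "z \<in> \<hh> \<Longrightarrow> killing (kd \<alpha>) z = \<alpha> z" "\<alpha> (kd \<alpha>) \<noteq> 0"
proof -
  obtain x where x: "x \<in> gs \<alpha>" "x \<noteq> 0" using roots_weights[OF \<alpha>] weightE by metis
  obtain y where y: "y \<in> gs (- \<alpha>)" "killing x y \<noteq> 0"
    using killing_pairing(2)[OF x(1) roots_weights[OF \<alpha>] x(2)] by blast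
  let ?k = "inverse (killing x y)"
  have t: "lie x y \<in> \<hh>" using x y by (intro lie_opposite_mem)
  have h: "scale ?k (lie x y) \<in> \<hh>"
    using subspace_scale[OF subspace_cartan t] .
  have k: "killing (scale ?k (lie x y)) z = \<alpha> z" if "z \<in> \<hh>" for z
    using killing_opposite_bracket[OF x(1) y(1) that] y(2) by (simp add: killing_scale_left)
  have eq: "kd \<alpha> = scale ?k (lie x y)" using h k by (rule killing_dual_eqI)
  show "kd \<alpha> \<in> \<hh>" "z \<in> \<hh> \<Longrightarrow> killing (kd \<alpha>) z = \<alpha> z" using h k by (auto simp: eq)
  obtain z where z: "z \<in> \<hh>" "\<alpha> z \<noteq> 0"
    using dual_space_eqI[OF roots_dual[OF \<alpha>] dual_space_0] \<alpha> zero_notin_roots by (metis zero_fun_apply)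
  then have "lie x y \<noteq> 0"
    using killing_opposite_bracket[OF x(1) y(1) z(1)] y(2) by auto
  then have "\<alpha> (lie x y) \<noteq> 0"
    using opposite_bracket_nonisotropic(1)[OF x(1) y(1) roots_weights[OF \<alpha>]] by blast
  moreover have "\<alpha> (scale ?k (lie x y)) = ?k * \<alpha> (lie x y)"
    using roots_dual[OF \<alpha>] t by (auto simp: dual_space_def)
  ultimately show "\<alpha> (kd \<alpha>) \<noteq> 0" using y(2) by (simp add: eq)
qed

text \<open>Both sides have the same Killing product with every element of \<hh>.\<close>

lemma lie_opposite:
  assumes "\<alpha> \<in> \<Delta>" "x \<in> gs \<alpha>" "y \<in> gs (- \<alpha>)"
  shows "lie x y = scale (killing x y) (kd \<alpha>)"
proof -
  have "lie x y - scale (killing x y) (kd \<alpha>) = 0"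
  proof (rule cartan_nondegenerate)
    show "lie x y - scale (killing x y) (kd \<alpha>) \<in> \<hh>"
      using assms killing_dual_root
      by (intro subspace_diff subspace_scale subspace_cartan lie_opposite_mem)
    show "killing (lie x y - scale (killing x y) (kd \<alpha>)) z = 0" if "z \<in> \<hh>" for z
      using that assms killing_opposite_bracket killing_dual_root
      by (simp add: killing_diff_left killing_scale_left)
  qed
  then show ?thesis by simp
qed

abbreviation "cr \<equiv> coroot \<hh>"

lemma coroot_mem: "\<alpha> \<in> \<Delta> \<Longrightarrow> cr \<alpha> \<in> \<hh>"
  unfolding coroot_def by (intro subspace_scale subspace_cartan killing_dual_root)

lemma dual_scale: "\<mu> \<in> dual \<Longrightarrow> x \<in> \<hh> \<Longrightarrow> \<mu> (scale k x) = k * \<mu> x"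
  and dual_add: "\<mu> \<in> dual \<Longrightarrow> x \<in> \<hh> \<Longrightarrow> y \<in> \<hh> \<Longrightarrow> \<mu> (x + y) = \<mu> x + \<mu> y"
  by (auto simp: dual_space_def)

lemma root_coroot: "\<alpha> \<in> \<Delta> \<Longrightarrow> \<alpha> (cr \<alpha>) = 2"
  using killing_dual_root[of \<alpha>] roots_dual[of \<alpha>] by (simp add: coroot_def dual_scale)

lemma killing_dual_uminus: assumes "\<alpha> \<in> \<Delta>" shows "kd (- \<alpha>) = - kd \<alpha>"
  using assms killing_dual_root[OF assms] killing_scale_left[of "-1" "kd \<alpha>"]
  by (intro killing_dual_eqI) (auto intro: subspace_neg[OF subspace_cartan])

lemma dual_minus: "\<mu> \<in> dual \<Longrightarrow> x \<in> \<hh> \<Longrightarrow> \<mu> (- x) = - \<mu> x"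
  using dual_scale[of \<mu> x "-1"] by simp

lemma coroot_uminus: "\<alpha> \<in> \<Delta> \<Longrightarrow> cr (- \<alpha>) = - cr \<alpha>"
  using killing_dual_root(1)[of \<alpha>] roots_dual[of \<alpha>]
  by (simp add: coroot_def killing_dual_uminus dual_minus)

text \<open>The bracket is a multiple of \<open>kd \<alpha>\<close> by \<open>lie_opposite\<close>;
  rescaling the partner turns it into the coroot, so that \<open>e\<close>,
  \<open>cr \<alpha>\<close>, \<open>f\<close> form an sl2-triple.\<close>

lemma sl2_partner:
  assumes "\<alpha> \<in> \<Delta>" "e \<in> gs \<alpha>" "e \<noteq> 0"
  shows "\<exists>f\<in>gs (- \<alpha>). lie e f = cr \<alpha>"
proof -
  obtain y where y: "y \<in> gs (- \<alpha>)" "killing e y \<noteq> 0"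
    using killing_pairing(2)[OF assms(2) roots_weights[OF assms(1)] assms(3)] by blast
  let ?f = "scale (2 / \<alpha> (kd \<alpha>) / killing e y) y"
  have "?f \<in> gs (- \<alpha>)" using y by (intro subspace_scale subspace_root_space)
  moreover have "lie e ?f = cr \<alpha>"
    using y lie_opposite[OF assms(1,2) y(1)] by (simp add: lie_scale_right coroot_def)
  ultimately show ?thesis by blast
qed

lemma lie_pow_root_space:
  assumes "f \<in> gs \<beta>" "v \<in> gs \<mu>"
  shows "(lie f ^^ j) v \<in> gs (\<mu> + zmul (int j) \<beta>)"
proof (induction j)
  case (Suc j)
  have "lie f ((lie f ^^ j) v) \<in> gs (\<beta> + (\<mu> + zmul (int j) \<beta>))"
    using assms Suc by (intro root_space_lie)
  moreover have "\<beta> + (\<mu> + zmul (int j) \<beta>) = \<mu> + zmul (int (Suc j)) \<beta>"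
    by (auto simp: fun_eq_iff algebra_simps)
  ultimately show ?case by (simp only: funpow.simps o_apply)
qed (use assms in simp)

text \<open>The weights of the successive powers are pairwise distinct, and there are finitely many
  weights.\<close>

lemma lie_pow_eventually_0:
  assumes "f \<in> gs \<beta>" "v \<in> gs \<mu>" "\<beta> \<in> \<Delta>" "\<mu> \<in> dual"
  shows "\<exists>k. (lie f ^^ k) v = 0"
proof (rule ccontr)
  assume "\<not> ?thesis"
  then have "\<mu> + zmul (int j) \<beta> \<in> weights" for j
    using weightI[OF lie_pow_root_space[OF assms(1,2), of j]] roots_dual[OF assms(3)] assms(4)
    by (auto intro: dual_space_add dual_space_zmul)
  then have "range (\<lambda>j::nat. \<mu> + zmul (int j) \<beta>) \<subseteq> weights" by auto
  moreover have "inj (\<lambda>j::nat. \<mu> + zmul (int j) \<beta>)"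
  proof (rule injI)
    fix i j :: nat assume "\<mu> + zmul (int i) \<beta> = \<mu> + zmul (int j) \<beta>"
    then have "(\<mu> + zmul (int i) \<beta>) x = (\<mu> + zmul (int j) \<beta>) x" for x by simp
    moreover obtain x where "\<beta> x \<noteq> 0" using assms(3) zero_notin_roots by (metis ext zero_fun_apply)
    ultimately have "of_nat i * \<beta> x = of_nat j * \<beta> x" "\<beta> x \<noteq> 0" by auto
    then show "i = j" by simp
  qed
  ultimately show False
    using finite_weights finite_imageD infinite_UNIV_nat finite_subset by metis
qed

text \<open>The standard sl2 computation: moving \<open>e\<close> past each \<open>f\<close>
  produces the eigenvalues \<open>m - 2 j\<close> of the coroot with
  \<open>m = \<mu> (cr \<alpha>)\<close>, and these add up to the stated factor.\<close>

lemma sl2_raise_lower: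
  assumes e: "e \<in> gs \<alpha>" and f: "f \<in> gs (- \<alpha>)" and ef: "lie e f = cr \<alpha>" and \<alpha>: "\<alpha> \<in> \<Delta>"
    and v: "v \<in> gs \<mu>" "lie e v = 0"
  shows "lie e ((lie f ^^ Suc j) v)
    = scale (of_nat (Suc j) * (\<mu> (cr \<alpha>) - of_nat j)) ((lie f ^^ j) v)"
proof -
  have h: "lie (cr \<alpha>) ((lie f ^^ j) v) = scale (\<mu> (cr \<alpha>) - 2 * of_nat j) ((lie f ^^ j) v)" for j
    using lie_pow_root_space[OF f v(1), of j] coroot_mem[OF \<alpha>] root_coroot[OF \<alpha>]
    by (auto simp: root_space_def algebra_simps)
  show ?thesis
  proof (induction j)
    case 0
    show ?case using h[of 0] by (simp add: lie_leibniz[of e f] ef v)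
  next
    case (Suc j)
    let ?w = "(lie f ^^ Suc j) v"
    have "lie e ((lie f ^^ Suc (Suc j)) v) = lie (cr \<alpha>) ?w + lie f (lie e ?w)"
      by (simp add: lie_leibniz[of e f] ef)
    also have "lie f (lie e ?w) = scale (of_nat (Suc j) * (\<mu> (cr \<alpha>) - of_nat j)) ?w"
      unfolding Suc by (simp add: lie_scale_right)
    also have "lie (cr \<alpha>) ?w + \<dots> =
        scale (of_nat (Suc (Suc j)) * (\<mu> (cr \<alpha>) - of_nat (Suc j))) ?w"
      unfolding h scale_left_distrib[symmetric] by (simp add: algebra_simps)
    finally show ?case .
  qed
qed

text \<open>If \<open>l + 1\<close> is the first power of \<open>f\<close> killing \<open>v\<close>,
  raising once gives \<open>(l + 1) (\<mu> (cr \<alpha>) - l) = 0\<close>.\<close>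

lemma sl2_highest_vector:
  assumes e: "e \<in> gs \<alpha>" and f: "f \<in> gs (- \<alpha>)" and ef: "lie e f = cr \<alpha>" and \<alpha>: "\<alpha> \<in> \<Delta>"
    and v: "v \<in> gs \<mu>" "lie e v = 0" "v \<noteq> 0" "\<mu> \<in> dual"
  shows "\<exists>l::nat. \<mu> (cr \<alpha>) = of_nat l \<and> (\<forall>j\<le>l. (lie f ^^ j) v \<noteq> 0)"
proof -
  define k where "k = (LEAST k. (lie f ^^ k) v = 0)"
  have k0: "(lie f ^^ k) v = 0"
    unfolding k_def using lie_pow_eventually_0[OF f v(1) roots_uminus[OF \<alpha>] v(4)] by (rule LeastI_ex)
  have kl: "(lie f ^^ j) v \<noteq> 0" if "j < k" for j
    using that not_less_Least unfolding k_def by blast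
  obtain l where l: "k = Suc l" using k0 v(3) by (cases k) auto
  have "scale (of_nat (Suc l) * (\<mu> (cr \<alpha>) - of_nat l)) ((lie f ^^ l) v) = 0"
    using sl2_raise_lower[OF e f ef \<alpha> v(1,2), of l] k0 unfolding l by (simp del: funpow.simps)
  then have "of_nat (Suc l) * (\<mu> (cr \<alpha>) - of_nat l) = 0"
    using kl[of l] l unfolding scale_eq_0_iff by blast
  then have "\<mu> (cr \<alpha>) - of_nat l = 0" by (simp only: mult_eq_0_iff of_nat_eq_0_iff) simp
  then show ?thesis using kl l by (intro exI[of _ l]) auto
qed

text \<open>Subtract from \<open>y\<close> the multiple of \<open>x\<close> with the same Killing
  product with \<open>f\<close>. The difference commutes with \<open>f\<close>; were it non-zero, it
  would be a highest vector for the triple of \<open>- \<alpha>\<close>, of weight -2, which is not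
  a natural number.\<close>

lemma root_space_1dim:
  assumes \<alpha>: "\<alpha> \<in> \<Delta>" and x: "x \<in> gs \<alpha>" "x \<noteq> 0" and y: "y \<in> gs \<alpha>"
  shows "\<exists>k. y = scale k x"
proof -
  obtain f where f: "f \<in> gs (- \<alpha>)" "lie x f = cr \<alpha>" using sl2_partner[OF \<alpha> x] by blast
  have "killing x f \<noteq> 0"
    using lie_opposite[OF \<alpha> x(1) f(1)] f(2) root_coroot[OF \<alpha>] roots_dual[OF \<alpha>] dual_scale[of \<alpha> 0 0] subspace_0[OF subspace_cartan]
    by auto
  define k where "k = killing y f / killing x f"
  let ?z = "y - scale k x"
  have z: "?z \<in> gs \<alpha>" using x y by (intro subspace_diff subspace_scale subspace_root_space)
  have "killing ?z f = 0"
    using \<open>killing x f \<noteq> 0\<close> by (simp add: killing_diff_left killing_scale_left k_def)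
  then have fz: "lie f ?z = 0"
    using lie_opposite[OF \<alpha> z f(1)] lie_anticomm[of f ?z] by simp
  have "?z = 0"
  proof (rule ccontr)
    assume nz: "?z \<noteq> 0"
    have "lie f x = cr (- \<alpha>)" using f(2) lie_anticomm[of f x] coroot_uminus[OF \<alpha>] by simp
    then have "\<exists>l::nat. \<alpha> (cr (- \<alpha>)) = of_nat l \<and> (\<forall>j\<le>l. (lie x ^^ j) ?z \<noteq> 0)"
      using x(1) by (intro sl2_highest_vector[OF f(1) _ _ roots_uminus[OF \<alpha>] z fz nz roots_dual[OF \<alpha>]]) auto
    then obtain l :: nat where "\<alpha> (cr (- \<alpha>)) = of_nat l" by blast
    then have "- 2 = (of_nat l :: complex)"
      using \<alpha> by (simp add: coroot_uminus dual_minus roots_dual coroot_mem root_coroot)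
    then have "Re (- 2) = Re (of_nat l)" by (rule arg_cong)
    then show False by simp
  qed
  then show ?thesis by (intro exI[of _ k]) simp
qed

end

section \<open>Root strings and reflections\<close>

context simple_cartan
begin

text \<open>On weights the value is already an integer (lemma \<open>cint\<close>); the floor only
  moves it into type \<open>int\<close>.\<close>

definition cint :: "('g \<Rightarrow> complex) \<Rightarrow> ('g \<Rightarrow> complex) \<Rightarrow> int" where
  "cint \<beta> \<alpha> = \<lfloor>Re (\<beta> (cr \<alpha>))\<rfloor>"

lemma root_vector: assumes "\<mu> \<in> weights" obtains v where "v \<in> gs \<mu>" "v \<noteq> 0"
  using weightE[OF assms] by metis

text \<open>From a vector of weight \<beta> one raises \<open>p\<close> times to reach a highest
  vector; its weight at the coroot is \<open>l\<close>, and the \<open>l + 1\<close> vectors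
  obtained by lowering it are non-zero.\<close>

lemma root_string:
  assumes \<alpha>: "\<alpha> \<in> \<Delta>" and \<beta>: "\<beta> \<in> weights"
  shows "\<exists>(p::nat) (l::nat). \<beta> (cr \<alpha>) = of_nat l - 2 * of_nat p \<and>
    (\<forall>j\<le>l. \<beta> + zmul (int p - int j) \<alpha> \<in> weights)"
proof -
  obtain v where v: "v \<in> gs \<beta>" "v \<noteq> 0" using root_vector[OF \<beta>] .
  obtain e where e: "e \<in> gs \<alpha>" "e \<noteq> 0" using root_vector[OF roots_weights[OF \<alpha>]] .
  obtain f where f: "f \<in> gs (- \<alpha>)" "lie e f = cr \<alpha>" using sl2_partner[OF \<alpha> e] by blast
  define k where "k = (LEAST k. (lie e ^^ k) v = 0)"
  have k0: "(lie e ^^ k) v = 0"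
    unfolding k_def using lie_pow_eventually_0[OF e(1) v(1) \<alpha> weights_dual[OF \<beta>]] by (rule LeastI_ex)
  obtain p where p: "k = Suc p" using k0 v(2) by (cases k) auto
  define z where "z = (lie e ^^ p) v"
  have z: "z \<noteq> 0" "lie e z = 0" "z \<in> gs (\<beta> + zmul (int p) \<alpha>)"
    using not_less_Least[of p "\<lambda>k. (lie e ^^ k) v = 0"] k0 p lie_pow_root_space[OF e(1) v(1), of p]
    by (auto simp: z_def k_def)
  have d: "\<beta> + zmul (int p) \<alpha> \<in> dual"
    using weights_dual[OF \<beta>] roots_dual[OF \<alpha>] by (intro dual_space_add dual_space_zmul)
  obtain l :: nat where l: "(\<beta> + zmul (int p) \<alpha>) (cr \<alpha>) = of_nat l" "\<And>j. j \<le> l \<Longrightarrow> (lie f ^^ j) z \<noteq> 0"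
    using sl2_highest_vector[OF e(1) f \<alpha> z(3,2,1) d] by blast
  have "\<beta> + zmul (int p - int j) \<alpha> \<in> weights" if "j \<le> l" for j
  proof -
    have eq: "\<beta> + zmul (int p) \<alpha> + zmul (int j) (- \<alpha>) = \<beta> + zmul (int p - int j) \<alpha>"
      by (simp add: zmul_uminus_right zmul_diff)
    show ?thesis
      using weightI[OF lie_pow_root_space[OF f(1) z(3), of j]] l(2)[OF that] d roots_dual[OF \<alpha>]
      unfolding eq[symmetric] by (auto intro: dual_space_add dual_space_zmul dual_space_minus)
  qed
  moreover have "\<beta> (cr \<alpha>) = of_nat l - 2 * of_nat p"
    using l(1) root_coroot[OF \<alpha>] by (simp add: algebra_simps)
  ultimately show ?thesis by blast
qed

lemma cint: assumes "\<alpha> \<in> \<Delta>" "\<beta> \<in> weights" shows "\<beta> (cr \<alpha>) = of_int (cint \<beta> \<alpha>)"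
proof -
  obtain p l :: nat where "\<beta> (cr \<alpha>) = of_nat l - 2 * of_nat p" using root_string[OF assms] by blast
  then have *: "\<beta> (cr \<alpha>) = of_int (int l - 2 * int p)" by simp
  then have "Re (\<beta> (cr \<alpha>)) = of_int (int l - 2 * int p)" by (simp only: complex_Re_of_int)
  then have "cint \<beta> \<alpha> = int l - 2 * int p" unfolding cint_def by (simp only: floor_of_int)
  then show ?thesis using * by simp
qed

lemma cint_eqI: "\<alpha> \<in> \<Delta> \<Longrightarrow> \<beta> (cr \<alpha>) = of_int m \<Longrightarrow> cint \<beta> \<alpha> = m"
  by (simp add: cint_def)

lemma cint_uminus: "\<alpha> \<in> \<Delta> \<Longrightarrow> \<beta> \<in> weights \<Longrightarrow> cint \<beta> (- \<alpha>) = - cint \<beta> \<alpha>"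
  by (intro cint_eqI)
    (simp_all add: roots_uminus coroot_uminus dual_minus weights_dual coroot_mem cint)

text \<open>Counted from the top of the string the weight sits at step \<open>p + i\<close>, and
  \<open>i \<le> l - 2 p\<close> keeps this within \<open>l\<close>.\<close>

lemma string_down:
  assumes "\<alpha> \<in> \<Delta>" "\<beta> \<in> weights" "0 \<le> i" "i \<le> cint \<beta> \<alpha>"
  shows "\<beta> - zmul i \<alpha> \<in> weights"
proof -
  obtain p l :: nat where *: "\<beta> (cr \<alpha>) = of_nat l - 2 * of_nat p"
    "\<And>j. j \<le> l \<Longrightarrow> \<beta> + zmul (int p - int j) \<alpha> \<in> weights" using root_string[OF assms(1,2)] by blast
  have "cint \<beta> \<alpha> = int l - 2 * int p" using assms *(1) by (intro cint_eqI) auto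
  then have "nat (int p + i) \<le> l" using assms by auto
  from *(2)[OF this] show ?thesis using assms(3) by (simp add: zmul_minus)
qed

lemma string_up:
  assumes "\<alpha> \<in> \<Delta>" "\<beta> \<in> weights" "0 \<le> i" "i \<le> - cint \<beta> \<alpha>"
  shows "\<beta> + zmul i \<alpha> \<in> weights"
  using string_down[OF roots_uminus[OF assms(1)] assms(2,3)] assms
  by (simp add: cint_uminus zmul_uminus_right)

definition reflection :: "('g \<Rightarrow> complex) \<Rightarrow> ('g \<Rightarrow> complex) \<Rightarrow> ('g \<Rightarrow> complex)" where
  "reflection \<alpha> \<beta> = \<beta> - zmul (cint \<beta> \<alpha>) \<alpha>"

lemma reflection_coroot: assumes "\<alpha> \<in> \<Delta>" "\<beta> \<in> weights" shows "reflection \<alpha> \<beta> (cr \<alpha>) = - \<beta> (cr \<alpha>)"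
  using assms by (simp add: reflection_def root_coroot cint)

lemma cint_reflection: "\<alpha> \<in> \<Delta> \<Longrightarrow> \<beta> \<in> weights \<Longrightarrow> cint (reflection \<alpha> \<beta>) \<alpha> = - cint \<beta> \<alpha>"
  by (intro cint_eqI) (simp_all add: reflection_coroot cint)

lemma reflection_reflection: "\<alpha> \<in> \<Delta> \<Longrightarrow> \<beta> \<in> weights \<Longrightarrow> reflection \<alpha> (reflection \<alpha> \<beta>) = \<beta>"
  unfolding reflection_def[of \<alpha> "reflection \<alpha> \<beta>"] cint_reflection by (simp add: reflection_def zmul_minus)

text \<open>The reflected weight is reached along the string, upwards or downwards according to the
  sign of \<open>cint \<beta> \<alpha>\<close>. It is not zero because the reflection is an
  involution fixing zero.\<close>

lemma reflection_root:
  assumes "\<alpha> \<in> \<Delta>" "\<beta> \<in> \<Delta>"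
  shows "reflection \<alpha> \<beta> \<in> \<Delta>"
proof -
  have w: "\<beta> \<in> weights" using assms by (simp add: roots_weights)
  have "reflection \<alpha> \<beta> \<in> weights"
  proof (cases "cint \<beta> \<alpha> \<ge> 0")
    case True then show ?thesis using string_down[OF assms(1) w True] by (simp add: reflection_def)
  next
    case False
    then show ?thesis using string_up[OF assms(1) w, of "- cint \<beta> \<alpha>"] by (simp add: reflection_def zmul_minus)
  qed
  moreover have "reflection \<alpha> \<beta> \<noteq> 0"
  proof
    assume 0: "reflection \<alpha> \<beta> = 0"
    have "cint 0 \<alpha> = 0" using assms(1) by (intro cint_eqI) auto
    then have "reflection \<alpha> (0::'g \<Rightarrow> complex) = 0" by (simp add: reflection_def)
    then have "\<beta> = 0" using reflection_reflection[OF assms(1) w] 0 by simp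
    then show False using assms(2) by simp
  qed
  ultimately show ?thesis using weights_cases by blast
qed

lemma bij_reflection: assumes "\<alpha> \<in> \<Delta>" shows "bij_betw (reflection \<alpha>) \<Delta> \<Delta>"
  by (rule bij_betw_byWitness[where f'="reflection \<alpha>"])
    (use assms reflection_root reflection_reflection roots_weights in auto)

text \<open>Root spaces are lines, so basis vectors of equal non-zero weight are proportional. Sums
  over \<open>wbasis\<close> thereby become sums over roots.\<close>

lemma wt_inj: "inj_on wt {c \<in> wbasis. wt c \<noteq> 0}"
proof (rule inj_onI)
  fix c d assume c: "c \<in> {c \<in> wbasis. wt c \<noteq> 0}" and d: "d \<in> {c \<in> wbasis. wt c \<noteq> 0}" and eq: "wt c = wt d"
  have "wt c \<in> \<Delta>" using c by (auto simp: roots_eq weights_def)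
  then obtain k where k: "d = scale k c"
    using root_space_1dim[of "wt c" c d] wt[of c] wt[of d] wbasis_nonzero c d eq by auto
  show "c = d"
  proof (rule ccontr)
    assume "c \<noteq> d"
    then have "scale k c \<in> span (wbasis - {d})" using c by (intro span_scale span_base) auto
    then have "d \<in> span (wbasis - {d})" unfolding k[symmetric] .
    then show False using wbasis(2) d unfolding dependent_def by blast
  qed
qed

lemma killing_eq_sum_roots:
  assumes "x \<in> \<hh>" "y \<in> \<hh>"
  shows "killing x y = (\<Sum>\<beta>\<in>\<Delta>. \<beta> x * \<beta> y)"
proof -
  let ?C = "{c \<in> wbasis. wt c \<noteq> 0}"
  have "killing x y = (\<Sum>c\<in>?C. wt c x * wt c y)"
    unfolding killing_cartan[OF assms] by (intro sum.mono_neutral_right) auto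
  also have "\<dots> = (\<Sum>\<beta>\<in>wt ` ?C. \<beta> x * \<beta> y)"
    by (simp add: sum.reindex[OF wt_inj])
  also have "wt ` ?C = \<Delta>" by (auto simp: roots_eq weights_def)
  finally show ?thesis .
qed

section \<open>The inner product on roots\<close>

lemma killing_dual_commute:
  assumes "\<alpha> \<in> \<Delta>" "\<beta> \<in> \<Delta>"
  shows "\<alpha> (kd \<beta>) = \<beta> (kd \<alpha>)"
  using killing_dual_root[OF assms(1)] killing_dual_root[OF assms(2)] killing_commute by metis

text \<open>The form on the dual induced by the Killing form. The proof of \<open>ip_cint\<close>
  shows that for a weight against a root the value is real, so taking the real part loses nothing
  there.\<close>

definition ip :: "('g \<Rightarrow> complex) \<Rightarrow> ('g \<Rightarrow> complex) \<Rightarrow> real" where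
  "ip \<alpha> \<beta> = pairing \<alpha> (kd \<beta>)"

lemma ip_add: "ip (\<alpha> + \<beta>) \<gamma> = ip \<alpha> \<gamma> + ip \<beta> \<gamma>"
  and ip_diff: "ip (\<alpha> - \<beta>) \<gamma> = ip \<alpha> \<gamma> - ip \<beta> \<gamma>"
  and ip_zmul: "ip (zmul m \<alpha>) \<gamma> = of_int m * ip \<alpha> \<gamma>"
  and ip_zero [simp]: "ip 0 \<gamma> = 0"
  by (simp_all add: ip_def pairing_def)

lemma ip_commute: "\<alpha> \<in> \<Delta> \<Longrightarrow> \<beta> \<in> \<Delta> \<Longrightarrow> ip \<alpha> \<beta> = ip \<beta> \<alpha>"
  by (simp add: ip_def pairing_def killing_dual_commute)

lemma root_coroot_killing_dual:
  assumes "\<alpha> \<in> \<Delta>" "\<beta> \<in> weights"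
  shows "\<beta> (cr \<alpha>) = 2 * \<beta> (kd \<alpha>) / \<alpha> (kd \<alpha>)"
  using assms killing_dual_root[OF assms(1)] by (simp add: coroot_def dual_scale weights_dual)

text \<open>The Killing square of the coroot is a sum of squared Cartan integers and also
  \<open>4 / \<alpha> (kd \<alpha>)\<close>; hence square lengths of roots are real and
  positive.\<close>

lemma root_length:
  assumes \<alpha>: "\<alpha> \<in> \<Delta>"
  shows "of_int (\<Sum>\<beta>\<in>\<Delta>. (cint \<beta> \<alpha>)\<^sup>2) * \<alpha> (kd \<alpha>) = 4" "(\<Sum>\<beta>\<in>\<Delta>. (cint \<beta> \<alpha>)\<^sup>2) > 0"
proof -
  let ?a = "\<alpha> (kd \<alpha>)"
  note t = killing_dual_root[OF \<alpha>]
  have "killing (cr \<alpha>) (cr \<alpha>) = (\<Sum>\<beta>\<in>\<Delta>. of_int ((cint \<beta> \<alpha>)\<^sup>2))"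
    unfolding killing_eq_sum_roots[OF coroot_mem[OF \<alpha>] coroot_mem[OF \<alpha>]] using \<alpha>
    by (intro sum.cong) (simp_all add: cint roots_weights power2_eq_square)
  moreover have "killing (cr \<alpha>) (cr \<alpha>) = (2 / ?a) * (2 / ?a) * ?a"
    using t by (simp add: coroot_def killing_scale_left killing_scale_right)
  ultimately have S: "of_int (\<Sum>\<beta>\<in>\<Delta>. (cint \<beta> \<alpha>)\<^sup>2) = 4 / ?a"
    using t(3) by (simp add: field_simps)
  then show "of_int (\<Sum>\<beta>\<in>\<Delta>. (cint \<beta> \<alpha>)\<^sup>2) * ?a = 4" using t(3) by simp
  have "(\<Sum>\<beta>\<in>\<Delta>. (cint \<beta> \<alpha>)\<^sup>2) \<noteq> 0"
  proof
    assume "(\<Sum>\<beta>\<in>\<Delta>. (cint \<beta> \<alpha>)\<^sup>2) = 0"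
    with S have "4 / ?a = 0" by (metis of_int_0)
    then show False using t(3) by simp
  qed
  then show "(\<Sum>\<beta>\<in>\<Delta>. (cint \<beta> \<alpha>)\<^sup>2) > 0" by (simp add: order.strict_iff_order sum_nonneg)
qed

lemma ip_pos:
  assumes \<alpha>: "\<alpha> \<in> \<Delta>"
  shows "ip \<alpha> \<alpha> > 0" "\<alpha> (kd \<alpha>) = of_real (ip \<alpha> \<alpha>)"
proof -
  define S where "S = (\<Sum>\<beta>\<in>\<Delta>. (cint \<beta> \<alpha>)\<^sup>2)"
  have S: "of_int S * \<alpha> (kd \<alpha>) = 4" "S > 0" using root_length[OF \<alpha>] by (auto simp: S_def)
  then have a: "\<alpha> (kd \<alpha>) = of_real (4 / of_int S)" by (simp add: field_simps)
  then have "ip \<alpha> \<alpha> = 4 / of_int S" unfolding ip_def pairing_def by (simp only: Re_complex_of_real)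
  then show "ip \<alpha> \<alpha> > 0" "\<alpha> (kd \<alpha>) = of_real (ip \<alpha> \<alpha>)" using a S(2) by auto
qed

lemma ip_cint:
  assumes "\<alpha> \<in> \<Delta>" "\<beta> \<in> weights"
  shows "2 * ip \<beta> \<alpha> = of_int (cint \<beta> \<alpha>) * ip \<alpha> \<alpha>"
proof -
  have "\<beta> (kd \<alpha>) = of_int (cint \<beta> \<alpha>) * \<alpha> (kd \<alpha>) / 2"
    using root_coroot_killing_dual[OF assms] cint[OF assms] killing_dual_root(3)[OF assms(1)]
    by (simp add: field_simps)
  also have "\<dots> = of_real (of_int (cint \<beta> \<alpha>) * ip \<alpha> \<alpha> / 2)"
    using ip_pos(2)[OF assms(1)] by simp
  finally have "ip \<beta> \<alpha> = of_int (cint \<beta> \<alpha>) * ip \<alpha> \<alpha> / 2"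
    unfolding ip_def[of \<beta> \<alpha>] pairing_def by (simp only: Re_complex_of_real)
  then show ?thesis by simp
qed

lemma cint_pos_iff: "\<alpha> \<in> \<Delta> \<Longrightarrow> \<beta> \<in> weights \<Longrightarrow> cint \<beta> \<alpha> > 0 \<longleftrightarrow> ip \<beta> \<alpha> > 0"
  and cint_neg_iff: "\<alpha> \<in> \<Delta> \<Longrightarrow> \<beta> \<in> weights \<Longrightarrow> cint \<beta> \<alpha> < 0 \<longleftrightarrow> ip \<beta> \<alpha> < 0"
  using ip_cint[of \<alpha> \<beta>] ip_pos(1)[of \<alpha>]
  by (smt (verit, ccfv_SIG) mult_pos_pos mult_neg_pos mult_eq_0_iff of_int_0_less_iff of_int_less_0_iff of_int_0_eq_iff)+

lemma ip_reflection: "\<alpha> \<in> \<Delta> \<Longrightarrow> \<beta> \<in> weights \<Longrightarrow> ip (reflection \<alpha> \<beta>) \<alpha> = - ip \<beta> \<alpha>"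
  using ip_cint[of \<alpha> \<beta>] by (simp add: reflection_def ip_diff ip_zmul)

text \<open>The first step down the string. The conclusion speaks of weights because the difference
  may be zero.\<close>

lemma root_diff_weight: "\<alpha> \<in> \<Delta> \<Longrightarrow> \<beta> \<in> weights \<Longrightarrow> ip \<beta> \<alpha> > 0 \<Longrightarrow> \<beta> - \<alpha> \<in> weights"
  using string_down[of \<alpha> \<beta> 1] cint_pos_iff[of \<alpha> \<beta>] by simp

lemma root_add_weight: "\<alpha> \<in> \<Delta> \<Longrightarrow> \<beta> \<in> weights \<Longrightarrow> ip \<beta> \<alpha> < 0 \<Longrightarrow> \<beta> + \<alpha> \<in> weights"
  using string_up[of \<alpha> \<beta> 1] cint_neg_iff[of \<alpha> \<beta>] by simp

text \<open>Otherwise \<open>y\<close> is a highest vector and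
  \<open>m = \<beta> (cr \<alpha>)\<close> is natural. Raise a vector of weight
  \<open>\<alpha> + \<beta>\<close> to a highest vector \<open>w\<close>, then lower
  \<open>p + 1\<close> times into the line of \<open>y\<close>, which \<open>x\<close> kills. But
  raising must give the factor \<open>(p + 1) (l - p)\<close>, non-zero since
  \<open>l = m + 2 + 2 p\<close>.\<close>

lemma lie_root_vectors_nonzero:
  assumes \<alpha>: "\<alpha> \<in> \<Delta>" and \<beta>: "\<beta> \<in> \<Delta>" and sum: "\<alpha> + \<beta> \<in> \<Delta>"
    and x: "x \<in> gs \<alpha>" "x \<noteq> 0" and y: "y \<in> gs \<beta>" "y \<noteq> 0"
  shows "lie x y \<noteq> 0"
proof
  assume xy: "lie x y = 0"
  obtain f where f: "f \<in> gs (- \<alpha>)" "lie x f = cr \<alpha>" using sl2_partner[OF \<alpha> x] by blast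
  obtain m :: nat where m: "\<beta> (cr \<alpha>) = of_nat m"
    using sl2_highest_vector[OF x(1) f \<alpha> y(1) xy y(2) roots_dual[OF \<beta>]] by blast
  obtain v where v: "v \<in> gs (\<alpha> + \<beta>)" "v \<noteq> 0" using root_vector[OF roots_weights[OF sum]] .
  define k where "k = (LEAST k. (lie x ^^ k) v = 0)"
  have k0: "(lie x ^^ k) v = 0"
    unfolding k_def using lie_pow_eventually_0[OF x(1) v(1) \<alpha> roots_dual[OF sum]] by (rule LeastI_ex)
  obtain p where p: "k = Suc p" using k0 v(2) by (cases k) auto
  define w where "w = (lie x ^^ p) v"
  let ?\<mu> = "\<alpha> + \<beta> + zmul (int p) \<alpha>"
  have w: "w \<noteq> 0" "lie x w = 0" "w \<in> gs ?\<mu>"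
    using not_less_Least[of p "\<lambda>k. (lie x ^^ k) v = 0"] k0 p lie_pow_root_space[OF x(1) v(1), of p]
    by (auto simp: w_def k_def)
  have d: "?\<mu> \<in> dual" using roots_dual[OF sum] roots_dual[OF \<alpha>] by (intro dual_space_add[OF _ dual_space_zmul])
  obtain l :: nat where l: "?\<mu> (cr \<alpha>) = of_nat l" "\<And>j. j \<le> l \<Longrightarrow> (lie f ^^ j) w \<noteq> 0"
    using sl2_highest_vector[OF x(1) f \<alpha> w(3,2,1) d] by blast
  have "of_nat (m + 2 + 2 * p) = (of_nat l :: complex)"
    using l(1) m root_coroot[OF \<alpha>] by (simp add: algebra_simps)
  then have lm: "l = m + 2 + 2 * p" by (simp only: of_nat_eq_iff)
  let ?u = "(lie f ^^ Suc p) w"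
  have "?\<mu> + zmul (int (Suc p)) (- \<alpha>) = \<beta>"
    by (auto simp: fun_eq_iff algebra_simps)
  then have "?u \<in> gs \<beta>" using lie_pow_root_space[OF f(1) w(3), of "Suc p"] by (simp only:)
  then obtain q where "?u = scale q y" using root_space_1dim[OF \<beta> y] by blast
  then have "lie x ?u = 0" using xy by (simp add: lie_scale_right)
  then have "scale (of_nat (Suc p) * (of_nat l - of_nat p)) ((lie f ^^ p) w) = 0"
    using sl2_raise_lower[OF x(1) f \<alpha> w(3,2), of p] l(1) by simp
  moreover have "(lie f ^^ p) w \<noteq> 0" using l(2)[of p] lm by simp
  ultimately have "of_nat (Suc p) * (of_nat l - of_nat p) = (0 :: complex)"
    unfolding scale_eq_0_iff by blast
  then have "(of_nat l :: complex) = of_nat p" by (simp only: mult_eq_0_iff of_nat_eq_0_iff) simp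
  then have "l = p" by (simp only: of_nat_eq_iff)
  then show False using lm by simp
qed

text \<open>\<open>kd \<alpha>\<close> is the coroot times half the square length of \<alpha>, which
  is real.\<close>

lemma killing_dual_real_form: "\<alpha> \<in> \<Delta> \<Longrightarrow> kd \<alpha> \<in> real_form \<hh>"
  and sum_scale_real_form:
    "(\<And>i. i \<in> A \<Longrightarrow> v i \<in> real_form \<hh>) \<Longrightarrow> (\<Sum>i\<in>A. scale (of_real (r i)) (v i)) \<in> real_form \<hh>"
proof -
  interpret r: module "\<lambda>r. scale (complex_of_real r)"
    by standard (simp_all add: scale_right_distrib scale_left_distrib)
  show "kd \<alpha> \<in> real_form \<hh>" if \<alpha>: "\<alpha> \<in> \<Delta>"
  proof -
    have "kd \<alpha> = scale (of_real (ip \<alpha> \<alpha> / 2)) (cr \<alpha>)"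
      using ip_pos[OF \<alpha>] by (simp add: coroot_def)
    then show ?thesis unfolding real_form_def using \<alpha> by (simp only:) (intro r.span_scale r.span_base imageI)
  qed
  show "(\<Sum>i\<in>A. scale (of_real (r i)) (v i)) \<in> real_form \<hh>" if "\<And>i. i \<in> A \<Longrightarrow> v i \<in> real_form \<hh>"
    using that unfolding real_form_def by (intro r.span_sum r.span_scale)
qed

lemma dual_sum: "\<mu> \<in> dual \<Longrightarrow> (\<And>i. i \<in> A \<Longrightarrow> v i \<in> \<hh>) \<Longrightarrow> \<mu> (\<Sum>i\<in>A. v i) = (\<Sum>i\<in>A. \<mu> (v i))"
proof (induction A rule: infinite_finite_induct)
  case (insert i A)
  then show ?case using subspace_sum[OF subspace_cartan, of A v] by (simp add: dual_add)
qed (use dual_scale[of \<mu> 0 0] subspace_0[OF subspace_cartan] in auto)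

text \<open>
  The element is \<open>\<Sum>\<^bsub>\<beta>\<^esub> d \<beta> \<cdot> kd \<beta>\<close>: pairing \<open>\<beta>\<close> with \<open>reflection \<alpha> \<beta>\<close> gives
  \<open>2 \<Sum> d \<beta> \<cdot> cint \<beta> \<alpha> = d \<alpha> \<cdot> \<Sum> (cint \<beta> \<alpha>)\<^sup>2\<close>, and the last sum is \<open>4 / (\<alpha>, \<alpha>)\<close>.
\<close>

lemma coweight_of_reflection_equivariant:
  fixes d :: "('g \<Rightarrow> complex) \<Rightarrow> int"
  assumes d: "\<And>\<alpha> \<beta>. \<alpha> \<in> \<Delta> \<Longrightarrow> \<beta> \<in> \<Delta> \<Longrightarrow> d (reflection \<alpha> \<beta>) = d \<beta> - cint \<beta> \<alpha> * d \<alpha>"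
  shows "\<exists>\<tau>\<in>coweight_lattice \<hh>. \<forall>\<alpha>\<in>\<Delta>. pairing \<alpha> \<tau> = of_int (d \<alpha>)"
proof -
  define \<tau> where "\<tau> = (\<Sum>\<beta>\<in>\<Delta>. scale (of_real (of_int (d \<beta>))) (kd \<beta>))"
  have \<tau>: "\<alpha> \<tau> = of_int (d \<alpha>)" if \<alpha>: "\<alpha> \<in> \<Delta>" for \<alpha>
  proof -
    let ?S = "\<Sum>\<beta>\<in>\<Delta>. (cint \<beta> \<alpha>)\<^sup>2" and ?T = "\<Sum>\<beta>\<in>\<Delta>. d \<beta> * cint \<beta> \<alpha>" and ?a = "\<alpha> (kd \<alpha>)"
    have "?T = (\<Sum>\<beta>\<in>\<Delta>. d (reflection \<alpha> \<beta>) * cint (reflection \<alpha> \<beta>) \<alpha>)"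
      by (rule sum.reindex_bij_betw[OF bij_reflection[OF \<alpha>], symmetric])
    also have "\<dots> = (\<Sum>\<beta>\<in>\<Delta>. d \<alpha> * (cint \<beta> \<alpha>)\<^sup>2 - d \<beta> * cint \<beta> \<alpha>)"
      using \<alpha> by (intro sum.cong) (auto simp: d cint_reflection roots_weights power2_eq_square algebra_simps)
    finally have T: "2 * ?T = d \<alpha> * ?S" by (simp add: sum_subtractf sum_distrib_left)
    have "\<alpha> \<tau> = (\<Sum>\<beta>\<in>\<Delta>. \<alpha> (scale (of_real (of_int (d \<beta>))) (kd \<beta>)))"
      unfolding \<tau>_def using \<alpha> killing_dual_root(1)
      by (intro dual_sum roots_dual subspace_scale subspace_cartan)
    also have "\<dots> = (\<Sum>\<beta>\<in>\<Delta>. of_int (d \<beta> * cint \<beta> \<alpha>) * (?a / 2))"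
    proof (rule sum.cong[OF refl])
      fix \<beta> assume \<beta>: "\<beta> \<in> \<Delta>"
      have "\<alpha> (kd \<beta>) = of_int (cint \<beta> \<alpha>) * (?a / 2)"
        using cint[OF \<alpha> roots_weights[OF \<beta>]] root_coroot_killing_dual[OF \<alpha> roots_weights[OF \<beta>]]
          killing_dual_root(3)[OF \<alpha>] killing_dual_commute[OF \<alpha> \<beta>]
        by (simp add: field_simps)
      then show "\<alpha> (scale (of_real (of_int (d \<beta>))) (kd \<beta>)) = of_int (d \<beta> * cint \<beta> \<alpha>) * (?a / 2)"
        using \<alpha> \<beta> killing_dual_root(1)[OF \<beta>] by (simp add: dual_scale roots_dual)
    qed
    also have "\<dots> = of_int (2 * ?T) * ?a / 4" by (simp add: sum_distrib_left sum_divide_distrib mult_ac)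
    also have "\<dots> = of_int (d \<alpha>) * (of_int ?S * ?a) / 4" unfolding T by simp
    finally show ?thesis unfolding root_length(1)[OF \<alpha>] by simp
  qed
  have p\<tau>: "pairing \<alpha> \<tau> = of_int (d \<alpha>)" if "\<alpha> \<in> \<Delta>" for \<alpha>
    unfolding pairing_def \<tau>[OF that] by simp
  have "\<tau> \<in> coweight_lattice \<hh>"
    unfolding coweight_lattice_def
  proof (intro CollectI conjI ballI)
    show "\<tau> \<in> real_form \<hh>"
      unfolding \<tau>_def by (rule sum_scale_real_form) (rule killing_dual_real_form)
  qed (simp add: p\<tau>)
  then show ?thesis using p\<tau> by blast
qed

end

section \<open>Positive roots of a Borel subalgebra\<close>

text \<open>The additive semigroup generated by \<open>T\<close>: sums are non-empty, so zero
  belongs to it only through a vanishing sum.\<close>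

inductive_set psums :: "'a::comm_monoid_add set \<Rightarrow> 'a set" for T where
  base: "t \<in> T \<Longrightarrow> t \<in> psums T"
| step: "t \<in> T \<Longrightarrow> s \<in> psums T \<Longrightarrow> t + s \<in> psums T"

lemma psums_add: "x \<in> psums T \<Longrightarrow> y \<in> psums T \<Longrightarrow> x + y \<in> psums T"
  by (induction rule: psums.induct) (auto intro: psums.step simp: add.assoc)

lemma psums_list: "x \<in> psums T \<Longrightarrow> \<exists>xs. xs \<noteq> [] \<and> set xs \<subseteq> T \<and> x = sum_list xs"
proof (induction rule: psums.induct)
  case (base t)
  then show ?case by (intro exI[of _ "[t]"]) auto
next
  case (step t s)
  then obtain xs where "xs \<noteq> []" "set xs \<subseteq> T" "s = sum_list xs" by blast
  then show ?case using step(1) by (intro exI[of _ "t # xs"]) auto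
qed

lemma zmul_psums:
  assumes "s \<in> insert 0 (psums T)"
  shows "zmul (int k) s \<in> insert 0 (psums T)"
proof (induction k)
  case (Suc k)
  have "zmul (int (Suc k)) s = s + zmul (int k) s" by (simp add: fun_eq_iff algebra_simps)
  then show ?case using Suc assms psums_add[of s T "zmul (int k) s"] by (auto simp del: of_nat_Suc zmul_apply plus_fun_apply zero_fun_apply)
qed simp

text \<open>Isolates the copies of \<beta>; meant for the vanishing sum that appears when a further
  root is adjoined to the positive ones.\<close>

lemma psums_insert:
  assumes "x \<in> psums (insert \<beta> T)"
  shows "\<exists>k s. x = zmul (int k) \<beta> + s \<and> s \<in> insert 0 (psums T) \<and> (k > 0 \<or> s \<in> psums T)"
  using assms
proof (induction rule: psums.induct)
  case (base t)
  show ?case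
  proof (cases "t = \<beta>")
    case True
    then show ?thesis by (intro exI[of _ 1] exI[of _ 0]) auto
  next
    case False
    then show ?thesis using base by (intro exI[of _ 0] exI[of _ t]) (auto intro: psums.base)
  qed
next
  case (step t x)
  then obtain k s where ks: "x = zmul (int k) \<beta> + s" "s \<in> insert 0 (psums T)" "k > 0 \<or> s \<in> psums T"
    by blast
  show ?case
  proof (cases "t = \<beta>")
    case True
    have "t + x = zmul (int (Suc k)) \<beta> + s"
      by (simp add: True ks fun_eq_iff algebra_simps)
    then show ?thesis using ks(2) by blast
  next
    case False
    then have "t \<in> T" using step(1) by simp
    then have "t + s \<in> psums T" using ks(2) by (auto intro: psums.intros)
    moreover have "t + x = zmul (int k) \<beta> + (t + s)" by (simp add: ks add_ac)
    ultimately show ?thesis by blast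
  qed
qed

context simple_cartan
begin

text \<open>Such a set yields a solvable subalgebra containing \<hh>
  (\<open>solvable_of_closed_antisym\<close>); this is how maximality of the Borel subalgebra
  enters.\<close>

definition closed_antisym :: "('g \<Rightarrow> complex) set \<Rightarrow> bool" where
  "closed_antisym T \<longleftrightarrow> T \<subseteq> \<Delta> \<and> (\<forall>\<alpha>\<in>T. \<forall>\<beta>\<in>T. \<alpha> + \<beta> \<in> \<Delta> \<longrightarrow> \<alpha> + \<beta> \<in> T) \<and> (\<forall>\<alpha>\<in>T. - \<alpha> \<notin> T)"

text \<open>In a shortest vanishing sum some two summands have negative inner product; add them up.\<close>

lemma sum_list_roots_nonzero:
  assumes "closed_antisym T"
  shows "xs \<noteq> [] \<Longrightarrow> set xs \<subseteq> T \<Longrightarrow> sum_list xs \<noteq> 0"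
proof (induction xs rule: length_induct)
  case (1 xs)
  have T: "T \<subseteq> \<Delta>" using assms by (simp add: closed_antisym_def)
  show ?case
  proof
    assume 0: "sum_list xs = 0"
    obtain a ys where xs: "xs = a # ys" using 1(2) by (cases xs) auto
    have a: "a \<in> T" "a \<in> \<Delta>" using 1(3) T by (auto simp: xs)
    have ip_sum: "ip (sum_list zs) a = (\<Sum>z\<leftarrow>zs. ip z a)" for zs
      by (induction zs) (auto simp: ip_add simp del: plus_fun_apply zero_fun_apply)
    have "ip a a + (\<Sum>z\<leftarrow>ys. ip z a) = 0" using 0 ip_sum[of xs] by (simp add: xs)
    then have "(\<Sum>z\<leftarrow>ys. ip z a) < 0" using ip_pos(1)[OF a(2)] by linarith
    then have "\<not> (\<forall>z\<in>set ys. ip z a \<ge> 0)"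
      using sum_list_nonneg[of "map (\<lambda>z. ip z a) ys"] by auto
    then obtain b where b: "b \<in> set ys" "ip b a < 0" by (auto simp: not_le)
    have bT: "b \<in> T" using b 1(3) by (auto simp: xs)
    then have "b + a \<in> weights" using T a(2) b(2) by (intro root_add_weight roots_weights) auto
    moreover have "b + a \<noteq> 0"
      using assms a(1) bT by (auto simp: closed_antisym_def add_eq_0_iff2)
    ultimately have "b + a \<in> \<Delta>" using weights_cases by blast
    then have ba: "b + a \<in> T" using assms a(1) bT by (auto simp: closed_antisym_def)
    let ?zs = "(b + a) # remove1 b ys"
    have "length ?zs < length xs" using length_pos_if_in_set[OF b(1)] b(1) by (simp add: xs length_remove1)
    moreover have "set ?zs \<subseteq> T" using ba 1(3) set_remove1_subset[of b ys] by (auto simp: xs)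
    ultimately have "sum_list ?zs \<noteq> 0" using 1(1) by blast
    moreover have "sum_list ys = b + sum_list (remove1 b ys)"
      using sum_list_map_remove1[OF b(1), of "\<lambda>x. x"] by simp
    ultimately show False using 0 by (simp add: xs add_ac)
  qed
qed

lemma zero_notin_psums: "closed_antisym T \<Longrightarrow> 0 \<notin> psums T"
  using sum_list_roots_nonzero psums_list by metis

text \<open>Not the height in terms of simple roots: it counts the elements of \<open>T\<close>
  below \<alpha>, is bounded by \<open>card T\<close>, and grows strictly under addition.\<close>

definition ht :: "('g \<Rightarrow> complex) set \<Rightarrow> ('g \<Rightarrow> complex) \<Rightarrow> nat" where
  "ht T \<alpha> = card {\<beta>\<in>T. \<alpha> - \<beta> \<in> psums T}"

text \<open>Everything below \<beta> is below \<open>\<beta> + \<gamma>\<close>, and \<beta> itself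
  is gained, since zero is not in \<open>psums T\<close>.\<close>

lemma ht_add:
  assumes T: "closed_antisym T" and "\<beta> \<in> T" "\<gamma> \<in> T"
  shows "ht T \<beta> < ht T (\<beta> + \<gamma>)"
  unfolding ht_def
proof (rule psubset_card_mono)
  have "finite T" using T by (auto simp: closed_antisym_def intro: finite_subset[OF _ finite_roots])
  then show "finite {\<delta> \<in> T. \<beta> + \<gamma> - \<delta> \<in> psums T}" by simp
  have "\<beta> + \<gamma> - \<delta> \<in> psums T" if "\<beta> - \<delta> \<in> psums T" for \<delta>
    using psums.step[OF assms(3) that] by (simp add: algebra_simps)
  moreover have "\<beta> \<notin> {\<delta> \<in> T. \<beta> - \<delta> \<in> psums T}" using zero_notin_psums[OF T] by simp
  moreover have "\<beta> \<in> {\<delta> \<in> T. \<beta> + \<gamma> - \<delta> \<in> psums T}" using assms by (simp add: psums.base)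
  ultimately show "{\<delta> \<in> T. \<beta> - \<delta> \<in> psums T} \<subset> {\<delta> \<in> T. \<beta> + \<gamma> - \<delta> \<in> psums T}" by blast
qed

lemma ht_le: "closed_antisym T \<Longrightarrow> ht T \<alpha> \<le> card T"
  unfolding ht_def by (rule card_mono) (auto simp: closed_antisym_def intro: finite_subset[OF _ finite_roots])

lemma bracket_mono: "A \<subseteq> A' \<Longrightarrow> B \<subseteq> B' \<Longrightarrow> bracket A B \<subseteq> bracket A' B'"
  unfolding bracket_def by (rule span_mono) blast

text \<open>A non-zero bracket makes \<open>\<alpha> + \<beta>\<close> a weight, so only that case
  has to be checked when brackets of root spaces are placed in a span.\<close>

lemma lie_in_root_span:
  assumes "x \<in> gs \<alpha>" "y \<in> gs \<beta>" "\<alpha> \<in> weights" "\<beta> \<in> weights"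
    and "\<alpha> + \<beta> \<in> weights \<Longrightarrow> \<alpha> + \<beta> \<in> T"
  shows "lie x y \<in> span (\<Union>\<gamma>\<in>T. gs \<gamma>)"
proof (cases "lie x y = 0")
  case True then show ?thesis by (simp add: span_zero)
next
  case False
  have xy: "lie x y \<in> gs (\<alpha> + \<beta>)" using assms by (intro root_space_lie)
  then have "\<alpha> + \<beta> \<in> weights"
    using False assms(3,4)[THEN weights_dual] by (intro weightI[OF xy]) (auto intro: dual_space_add)
  then show ?thesis using assms(5) xy by (intro span_base) blast
qed

text \<open>The first derived space loses \<hh>, which is abelian; each further one raises the least
  \<open>ht\<close> of the roots involved, and \<open>ht\<close> is bounded.\<close>

lemma solvable_of_closed_antisym:
  assumes T: "closed_antisym T"
  shows "subalgebra (span (\<Union>\<mu>\<in>insert 0 T. gs \<mu>))" "solvable (span (\<Union>\<mu>\<in>insert 0 T. gs \<mu>))"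
proof -
  let ?B = "span (\<Union>\<mu>\<in>insert 0 T. gs \<mu>)"
  define N where "N k = span (\<Union>\<mu>\<in>{\<alpha>\<in>T. k \<le> ht T \<alpha>}. gs \<mu>)" for k
  have w: "\<mu> \<in> weights" if "\<mu> \<in> insert 0 T" for \<mu>
    using that T roots_weights zero_weight by (auto simp: closed_antisym_def)
  have add: "\<alpha> + \<beta> \<in> T" if "\<alpha> \<in> T" "\<beta> \<in> T" "\<alpha> + \<beta> \<in> weights" for \<alpha> \<beta>
  proof -
    have "\<alpha> + \<beta> \<noteq> 0" using T that by (auto simp: closed_antisym_def add_eq_0_iff)
    then show ?thesis using T that weights_cases by (auto simp: closed_antisym_def)
  qed
  have "bracket ?B ?B \<subseteq> N 0"
  proof (rule bracket_span_subset)
    fix x y assume "x \<in> (\<Union>\<mu>\<in>insert 0 T. gs \<mu>)" "y \<in> (\<Union>\<mu>\<in>insert 0 T. gs \<mu>)"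
    then obtain \<alpha> \<beta> where *: "\<alpha> \<in> insert 0 T" "x \<in> gs \<alpha>" "\<beta> \<in> insert 0 T" "y \<in> gs \<beta>" by auto
    show "lie x y \<in> N 0"
    proof (cases "\<alpha> = 0 \<and> \<beta> = 0")
      case True
      then have "lie x y = 0" using * root_space_0 lie_cartan by auto
      then show ?thesis by (simp add: N_def span_zero)
    next
      case False
      then have "lie x y \<in> span (\<Union>\<mu>\<in>T. gs \<mu>)"
        using * w add by (intro lie_in_root_span[OF *(2,4)]) auto
      then show ?thesis by (simp add: N_def)
    qed
  qed (simp add: N_def)
  note B0 = this
  have NN: "bracket (N k) (N k) \<subseteq> N (Suc k)" for k
    unfolding N_def[of k]
  proof (rule bracket_span_subset)
    fix x y assume "x \<in> (\<Union>\<mu>\<in>{\<alpha>\<in>T. k \<le> ht T \<alpha>}. gs \<mu>)" "y \<in> (\<Union>\<mu>\<in>{\<alpha>\<in>T. k \<le> ht T \<alpha>}. gs \<mu>)"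
    then obtain \<alpha> \<beta> where *: "\<alpha> \<in> T" "k \<le> ht T \<alpha>" "x \<in> gs \<alpha>" "\<beta> \<in> T" "y \<in> gs \<beta>" by auto
    have "Suc k \<le> ht T (\<alpha> + \<beta>)" using ht_add[OF T *(1,4)] *(2) by simp
    then show "lie x y \<in> N (Suc k)"
      unfolding N_def using * w add by (intro lie_in_root_span[OF *(3,5)]) auto
  qed (simp add: N_def)
  have "N 0 \<subseteq> ?B" unfolding N_def by (rule span_mono) auto
  then show "subalgebra ?B" using B0 by (auto simp: subalgebra_def)
  have "derived_series ?B (Suc k) \<subseteq> N k" for k
  proof (induction k)
    case (Suc k)
    have "derived_series ?B (Suc (Suc k)) \<subseteq> bracket (N k) (N k)"
      using bracket_mono[OF Suc Suc] by (simp del: zero_fun_apply)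
    then show ?case using NN by blast
  qed (use B0 in \<open>simp del: zero_fun_apply\<close>)
  \<comment> \<open>One \<open>Suc\<close> is the step that removes \<hh>, the other takes the bound
    on \<open>ht\<close> beyond \<open>card T\<close>.\<close>
  then have "derived_series ?B (Suc (Suc (card T))) \<subseteq> N (Suc (card T))" .
  moreover have "{\<alpha>\<in>T. Suc (card T) \<le> ht T \<alpha>} = {}"
    using ht_le[OF T] by (auto simp: not_le less_Suc_eq_le)
  then have "N (Suc (card T)) = {0}" unfolding N_def by (simp only: UN_empty span_empty)
  ultimately have "derived_series ?B (Suc (Suc (card T))) \<subseteq> {0}" by (simp only:)
  moreover have "0 \<in> derived_series ?B (Suc (Suc (card T)))"
    by (simp add: bracket_def span_zero)
  ultimately show "solvable ?B" unfolding solvable_def by blast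
qed

end

section \<open>Positive roots defined by the nilradical\<close>

locale borel_data = simple_cartan scale lie \<hh>
  for scale :: "complex \<Rightarrow> 'g::ab_group_add \<Rightarrow> 'g" and lie :: "'g \<Rightarrow> 'g \<Rightarrow> 'g" and \<hh> :: "'g set" +
  fixes \<bb> \<nn> :: "'g set"
  assumes borel: "borel_subalgebra \<bb>"
    and nilradical: "is_nilradical \<nn> \<bb>"
    and direct_sum: "is_direct_sum \<bb> \<hh> \<nn>"
begin

abbreviation "P \<equiv> pos_roots \<hh> \<nn>"

lemma subspace_nilradical: "subspace \<nn>"
  and nilradical_subset: "\<nn> \<subseteq> \<bb>"
  and lie_nilradical: "x \<in> \<bb> \<Longrightarrow> y \<in> \<nn> \<Longrightarrow> lie x y \<in> \<nn>"
  using nilradical lie_mem_bracket by (auto simp: is_nilradical_def ideal_def)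

lemma borel_eq: "\<bb> = {x + y | x y. x \<in> \<hh> \<and> y \<in> \<nn>}"
  and cartan_inter_nilradical: "\<hh> \<inter> \<nn> = {0}"
  using direct_sum by (auto simp: is_direct_sum_def)

lemma cartan_subset_borel: "\<hh> \<subseteq> \<bb>"
proof
  fix x assume "x \<in> \<hh>"
  then have "x + 0 \<in> \<bb>" unfolding borel_eq using subspace_0[OF subspace_nilradical] by blast
  then show "x \<in> \<bb>" by simp
qed

lemma pos_roots_roots: "\<alpha> \<in> P \<Longrightarrow> \<alpha> \<in> \<Delta>"
  and pos_roots_subset: "\<alpha> \<in> P \<Longrightarrow> gs \<alpha> \<subseteq> \<nn>"
  by (auto simp: pos_roots_def)

lemma finite_pos_roots [simp]: "finite P"
  using finite_subset[OF _ finite_roots] pos_roots_roots by blast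

lemma root_space_subset:
  assumes "subspace U" "\<alpha> \<in> \<Delta>" "v \<in> U" "v \<in> gs \<alpha>" "v \<noteq> 0"
  shows "gs \<alpha> \<subseteq> U"
  using root_space_1dim[OF assms(2,4,5)] subspace_scale[OF assms(1,3)] by auto

text \<open>Weight zero contributes nothing because \<hh> and \<nn> meet in zero, and a root space
  meeting \<open>U\<close> in a non-zero vector is a line contained in \<open>U\<close>.\<close>

lemma hstable_eq_span_roots:
  assumes "hstable U" "U \<subseteq> \<nn>"
  shows "U = span (\<Union>\<alpha>\<in>roots_of \<hh> \<nn> U. gs \<alpha>)"
proof
  have sub: "subspace U" using assms(1) by (simp add: hstable_def)
  then show "span (\<Union>\<alpha>\<in>roots_of \<hh> \<nn> U. gs \<alpha>) \<subseteq> U"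
    by (intro span_minimal) (auto simp: roots_of_def)
  have "v \<in> span (\<Union>\<alpha>\<in>roots_of \<hh> \<nn> U. gs \<alpha>)" if v: "v \<in> U" "v \<in> gs \<mu>" and \<mu>: "\<mu> \<in> weights" for v \<mu>
  proof (cases "v = 0")
    case True then show ?thesis by (simp add: span_zero)
  next
    case False
    have "\<mu> \<noteq> 0"
    proof
      assume "\<mu> = 0"
      then have "v \<in> \<hh> \<inter> \<nn>" using v assms(2) by (auto simp: root_space_0)
      then show False using False cartan_inter_nilradical by blast
    qed
    then have \<mu>': "\<mu> \<in> \<Delta>" using \<mu> weights_cases by blast
    then have "gs \<mu> \<subseteq> U" using root_space_subset[OF sub] v False by blast
    then have "\<mu> \<in> roots_of \<hh> \<nn> U" using \<mu>' assms(2) by (auto simp: roots_of_def pos_roots_def)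
    then show ?thesis using v(2) by (intro span_base) blast
  qed
  then have "span (\<Union>\<mu>\<in>weights. U \<inter> gs \<mu>) \<subseteq> span (\<Union>\<alpha>\<in>roots_of \<hh> \<nn> U. gs \<alpha>)"
    by (intro span_minimal) auto
  then show "U \<subseteq> span (\<Union>\<alpha>\<in>roots_of \<hh> \<nn> U. gs \<alpha>)"
    using hstable_eq_span[OF assms(1)] by blast
qed

lemma nilradical_eq_span: "\<nn> = span (\<Union>\<alpha>\<in>P. gs \<alpha>)"
proof -
  have "roots_of \<hh> \<nn> \<nn> = P" by (auto simp: roots_of_def pos_roots_def)
  moreover have "hstable \<nn>"
    unfolding hstable_def using subspace_nilradical lie_nilradical cartan_subset_borel by blast
  ultimately show ?thesis using hstable_eq_span_roots[of \<nn>] by simp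
qed

text \<open>One non-zero bracket already spans the root space of
  \<open>\<alpha> + \<beta>\<close>.\<close>

lemma lie_mem_root_space_subset:
  assumes "subspace U" "\<alpha> \<in> \<Delta>" "\<beta> \<in> \<Delta>" "\<alpha> + \<beta> \<in> \<Delta>"
    and "\<And>x y. x \<in> gs \<alpha> \<Longrightarrow> y \<in> gs \<beta> \<Longrightarrow> lie x y \<in> U"
  shows "gs (\<alpha> + \<beta>) \<subseteq> U"
proof -
  obtain x y where xy: "x \<in> gs \<alpha>" "x \<noteq> 0" "y \<in> gs \<beta>" "y \<noteq> 0"
    using root_vector roots_weights assms(2,3) by metis
  then show ?thesis
    using assms lie_root_vectors_nonzero[OF assms(2-4)] root_space_lie
    by (intro root_space_subset[OF assms(1,4), of "lie x y"]) auto
qed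

lemma pos_roots_add:
  assumes "\<alpha> \<in> P" "\<beta> \<in> P" "\<alpha> + \<beta> \<in> \<Delta>"
  shows "\<alpha> + \<beta> \<in> P"
proof -
  have "gs (\<alpha> + \<beta>) \<subseteq> \<nn>"
    using assms(1,2)[THEN pos_roots_subset] lie_nilradical nilradical_subset
    by (intro lie_mem_root_space_subset subspace_nilradical assms(1,2)[THEN pos_roots_roots] assms(3)) blast
  then show ?thesis using assms(3) by (simp add: pos_roots_def)
qed

text \<open>Otherwise the coroot, a bracket of two vectors of \<nn>, would lie in both \<hh> and
  \<nn> and be zero, while \<alpha> takes the value 2 on it.\<close>

lemma pos_roots_uminus: assumes "\<alpha> \<in> P" shows "- \<alpha> \<notin> P"
proof
  assume m: "- \<alpha> \<in> P"
  have \<alpha>: "\<alpha> \<in> \<Delta>" using assms by (rule pos_roots_roots)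
  obtain e where e: "e \<in> gs \<alpha>" "e \<noteq> 0" using root_vector[OF roots_weights[OF \<alpha>]] .
  obtain f where f: "f \<in> gs (- \<alpha>)" "lie e f = cr \<alpha>" using sl2_partner[OF \<alpha> e] by blast
  have "cr \<alpha> \<in> \<nn>"
    using e f pos_roots_subset[OF assms] pos_roots_subset[OF m] nilradical_subset lie_nilradical
    by (metis subsetD)
  then have "cr \<alpha> = 0" using coroot_mem[OF \<alpha>] cartan_inter_nilradical by blast
  then show False
    using root_coroot[OF \<alpha>] dual_scale[OF roots_dual[OF \<alpha>], of 0 0] subspace_0[OF subspace_cartan] by simp
qed

lemma closed_antisym_pos_roots: "closed_antisym P"
  using pos_roots_roots pos_roots_add pos_roots_uminus by (auto simp: closed_antisym_def)

text \<open>The solvable subalgebra built from \<open>T\<close> contains \<bb>, hence equals it. A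
  root vector is then \<open>x + y\<close> with \<open>x\<close> in \<hh> and \<open>y\<close> in
  \<nn>; bracketing with an element of \<hh> on which \<alpha> is non-zero removes
  \<open>x\<close>.\<close>

lemma closed_antisym_maximal:
  assumes T: "closed_antisym T" and "P \<subseteq> T"
  shows "T = P"
proof
  let ?B = "span (\<Union>\<mu>\<in>insert 0 T. gs \<mu>)"
  have "gs 0 \<subseteq> ?B" by (rule order.trans[OF _ span_superset]) blast
  then have "\<hh> \<subseteq> ?B" by (simp only: root_space_0)
  moreover have "\<nn> \<subseteq> ?B" by (rule ord_eq_le_trans[OF nilradical_eq_span]) (use assms(2) in \<open>intro span_mono; blast\<close>)
  ultimately have "\<bb> \<subseteq> ?B" unfolding borel_eq by (auto intro!: span_add simp del: UN_insert)
  then have B: "?B = \<bb>"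
    using borel solvable_of_closed_antisym[OF T] by (auto simp: borel_subalgebra_def)
  show "T \<subseteq> P"
  proof
    fix \<alpha> assume \<alpha>: "\<alpha> \<in> T"
    then have r: "\<alpha> \<in> \<Delta>" using T by (auto simp: closed_antisym_def)
    have "v \<in> \<nn>" if v: "v \<in> gs \<alpha>" for v
    proof -
      have "v \<in> ?B" using v \<alpha> by (intro span_base) blast
      then obtain x y where xy: "x \<in> \<hh>" "y \<in> \<nn>" "v = x + y" unfolding B borel_eq by blast
      obtain z where z: "z \<in> \<hh>" "\<alpha> z \<noteq> 0"
        using dual_space_eqI[OF roots_dual[OF r] dual_space_0] r zero_notin_roots by (metis zero_fun_apply)
      have "scale (\<alpha> z) v = lie z y"
        using v z xy lie_cartan[of z x] by (auto simp: root_space_def lie_add_right)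
      also have "\<dots> \<in> \<nn>" using xy z cartan_subset_borel by (intro lie_nilradical) auto
      finally have "scale (inverse (\<alpha> z)) (scale (\<alpha> z) v) \<in> \<nn>"
        by (rule subspace_scale[OF subspace_nilradical])
      then show ?thesis using z by simp
    qed
    then show "\<alpha> \<in> P" using r by (auto simp: pos_roots_def)
  qed
qed fact

text \<open>If adjoining \<beta> created no vanishing sum, the roots among the sums would form a
  closed set without opposite pairs, larger than \<open>P\<close>. In a vanishing sum \<beta> must
  occur, as \<open>P\<close> alone has none.\<close>

lemma negative_combination:
  assumes "\<beta> \<in> \<Delta>" "\<beta> \<notin> P"
  shows "\<exists>k>0. - zmul (int k) \<beta> \<in> insert 0 (psums P)"
proof -
  have "0 \<in> psums (insert \<beta> P)"
  proof (rule ccontr)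
    assume 0: "0 \<notin> psums (insert \<beta> P)"
    let ?T = "psums (insert \<beta> P) \<inter> \<Delta>"
    have "closed_antisym ?T"
      unfolding closed_antisym_def
    proof (intro conjI ballI impI)
      fix \<alpha> assume "\<alpha> \<in> ?T"
      then show "- \<alpha> \<notin> ?T" using psums_add[of \<alpha> "insert \<beta> P" "- \<alpha>"] 0 by auto
    qed (auto intro: psums_add)
    moreover have "P \<subseteq> ?T" using pos_roots_roots by (auto intro: psums.base)
    ultimately have "?T = P" by (rule closed_antisym_maximal)
    then show False using assms by (auto intro: psums.base)
  qed
  then obtain k s where ks: "0 = zmul (int k) \<beta> + s" "s \<in> insert 0 (psums P)" "k > 0 \<or> s \<in> psums P"
    using psums_insert by blast
  have "k > 0"
  proof (rule ccontr)
    assume "\<not> k > 0"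
    then show False using ks zero_notin_psums[OF closed_antisym_pos_roots] by auto
  qed
  moreover have "- zmul (int k) \<beta> = s" using ks(1) by (simp add: eq_neg_iff_add_eq_0 add.commute minus_unique)
  ultimately show ?thesis using ks(2) by blast
qed

text \<open>Otherwise \<open>- k \<beta>\<close> and \<open>l \<beta>\<close> are both zero or sums
  of positive roots, with \<open>k\<close> and \<open>l\<close> positive. The \<open>l\<close>-fold
  of the first and the \<open>k\<close>-fold of the second cancel, which \<open>P\<close> allows
  only if both are zero.\<close>

lemma pos_roots_total:
  assumes \<beta>: "\<beta> \<in> \<Delta>"
  shows "\<beta> \<in> P \<or> - \<beta> \<in> P"
proof (rule ccontr)
  assume "\<not> ?thesis"
  then obtain k l where k: "k > 0" "- zmul (int k) \<beta> \<in> insert 0 (psums P)"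
    and l: "l > 0" "- zmul (int l) (- \<beta>) \<in> insert 0 (psums P)"
    using negative_combination[OF \<beta>] negative_combination[OF roots_uminus[OF \<beta>]] by blast
  let ?a = "zmul (int l) (- zmul (int k) \<beta>)" and ?b = "zmul (int k) (- zmul (int l) (- \<beta>))"
  have ab: "?a \<in> insert 0 (psums P)" "?b \<in> insert 0 (psums P)" using k l by (auto intro!: zmul_psums simp del: insert_iff)
  have sum: "?a + ?b = 0" by (auto simp: fun_eq_iff)
  have z: "0 \<notin> psums P" by (rule zero_notin_psums[OF closed_antisym_pos_roots])
  have "?a = 0"
  proof (rule ccontr)
    assume "?a \<noteq> 0"
    then have a: "?a \<in> psums P" using ab(1) by simp
    then have "?b \<noteq> 0" using sum z by auto
    then have "?b \<in> psums P" using ab(2) by simp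
    from psums_add[OF a this] show False using sum z by simp
  qed
  then have "?a x = 0" for x by simp
  then have "\<beta> x = 0" for x using k(1) l(1) by simp
  then have "\<beta> = 0" by (simp add: fun_eq_iff)
  then show False using \<beta> by simp
qed

lemma pos_root_not_simple:
  assumes "\<alpha> \<in> P" "\<alpha> \<notin> simple_roots \<hh> \<nn>"
  obtains \<beta> \<gamma> where "\<beta> \<in> P" "\<gamma> \<in> P" "\<alpha> = \<beta> + \<gamma>"
  using assms by (auto simp: simple_roots_def plus_fun_def)

text \<open>Induction on \<open>ht\<close>: a positive root that is not simple is a sum of two
  positive roots of smaller \<open>ht\<close>.\<close>

lemma dominant_nonneg:
  assumes "\<And>\<alpha>. \<alpha> \<in> simple_roots \<hh> \<nn> \<Longrightarrow> pairing \<alpha> \<tau> \<ge> 0" "\<alpha> \<in> P"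
  shows "pairing \<alpha> \<tau> \<ge> 0"
  using assms(2)
proof (induction "ht P \<alpha>" arbitrary: \<alpha> rule: less_induct)
  case less
  show ?case
  proof (cases "\<alpha> \<in> simple_roots \<hh> \<nn>")
    case True then show ?thesis by (rule assms(1))
  next
    case False
    then obtain \<beta> \<gamma> where *: "\<beta> \<in> P" "\<gamma> \<in> P" "\<alpha> = \<beta> + \<gamma>"
      using less.prems pos_root_not_simple by blast
    have "ht P \<beta> < ht P \<alpha>" "ht P \<gamma> < ht P \<alpha>"
      using ht_add[OF closed_antisym_pos_roots *(1,2)] ht_add[OF closed_antisym_pos_roots *(2,1)] *(3)
      by (simp_all add: add.commute)
    then have "pairing \<beta> \<tau> \<ge> 0" "pairing \<gamma> \<tau> \<ge> 0" using less.hyps * by auto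
    then show ?thesis by (simp add: * pairing_def)
  qed
qed

lemma pairing_le_highest:
  assumes "\<And>\<alpha>. \<alpha> \<in> simple_roots \<hh> \<nn> \<Longrightarrow> pairing \<alpha> \<tau> \<ge> 0"
    and "is_highest_root \<hh> \<nn> \<theta>" "\<alpha> \<in> \<Delta>"
  shows "pairing \<alpha> \<tau> \<le> pairing \<theta> \<tau>"
proof -
  obtain c :: "('g \<Rightarrow> complex) \<Rightarrow> nat" where
    c: "\<theta> \<tau> - \<alpha> \<tau> = (\<Sum>\<beta>\<in>simple_roots \<hh> \<nn>. of_nat (c \<beta>) * \<beta> \<tau>)"
    using assms(2,3) unfolding is_highest_root_def by blast
  have "pairing \<theta> \<tau> - pairing \<alpha> \<tau> = (\<Sum>\<beta>\<in>simple_roots \<hh> \<nn>. of_nat (c \<beta>) * pairing \<beta> \<tau>)"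
    using arg_cong[OF c, of Re] by (simp add: pairing_def)
  also have "\<dots> \<ge> 0" using assms(1) by (intro sum_nonneg mult_nonneg_nonneg) auto
  finally show ?thesis by simp
qed

end

section \<open>Abelian ideals\<close>

locale abelian_ideal_data = borel_data scale lie \<hh> \<bb> \<nn>
  for scale :: "complex \<Rightarrow> 'g::ab_group_add \<Rightarrow> 'g" and lie :: "'g \<Rightarrow> 'g \<Rightarrow> 'g"
    and \<hh> \<bb> \<nn> :: "'g set" +
  fixes \<ii> :: "'g set"
  assumes ideal_borel: "ideal \<ii> \<bb>"
    and abelian_ideal: "abelian \<ii>"
begin

abbreviation "\<Phi> \<equiv> roots_of \<hh> \<nn> \<ii>"

lemma subspace_ideal: "subspace \<ii>"
  and lie_ideal: "x \<in> \<bb> \<Longrightarrow> y \<in> \<ii> \<Longrightarrow> lie x y \<in> \<ii>"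
  using ideal_borel lie_mem_bracket by (auto simp: ideal_def)

text \<open>An abelian ideal is nilpotent, and the nilradical contains every nilpotent
  ideal.\<close>

lemma ideal_subset_nilradical: "\<ii> \<subseteq> \<nn>"
proof -
  have "bracket \<ii> \<ii> \<subseteq> {0}"
    using abelian_ideal by (simp add: bracket_subset_iff abelian_def)
  moreover have "0 \<in> bracket \<ii> \<ii>" by (simp add: bracket_def span_zero)
  ultimately have "lower_central_series \<ii> 1 = {0}" by auto
  then have "nilpotent \<ii>" unfolding nilpotent_def by blast
  then show ?thesis using nilradical ideal_borel by (simp add: is_nilradical_def)
qed

lemma ideal_eq_span: "\<ii> = span (\<Union>\<alpha>\<in>\<Phi>. gs \<alpha>)"
  using subspace_ideal lie_ideal cartan_subset_borel
  by (intro hstable_eq_span_roots ideal_subset_nilradical) (auto simp: hstable_def)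

lemma ideal_roots_pos: "\<alpha> \<in> \<Phi> \<Longrightarrow> \<alpha> \<in> P"
  and ideal_roots_subset: "\<alpha> \<in> \<Phi> \<Longrightarrow> gs \<alpha> \<subseteq> \<ii>"
  and ideal_roots_roots: "\<alpha> \<in> \<Phi> \<Longrightarrow> \<alpha> \<in> \<Delta>"
  and ideal_roots_weights: "\<alpha> \<in> \<Phi> \<Longrightarrow> \<alpha> \<in> weights"
  using pos_roots_roots roots_weights by (auto simp: roots_of_def)

lemma finite_ideal_roots [simp]: "finite \<Phi>"
  using finite_subset[OF _ finite_pos_roots] ideal_roots_pos by blast

lemma pos_roots_sum_nonzero: "\<alpha> \<in> P \<Longrightarrow> \<beta> \<in> P \<Longrightarrow> \<alpha> + \<beta> \<noteq> 0"
  using pos_roots_uminus by (metis add_eq_0_iff)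

lemma pos_roots_sum_weight: "\<alpha> \<in> P \<Longrightarrow> \<beta> \<in> P \<Longrightarrow> \<alpha> + \<beta> \<in> weights \<Longrightarrow> \<alpha> + \<beta> \<in> \<Delta>"
  using pos_roots_sum_nonzero weights_cases by blast

lemma ideal_roots_add:
  assumes "\<alpha> \<in> \<Phi>" "\<beta> \<in> P" "\<alpha> + \<beta> \<in> weights"
  shows "\<alpha> + \<beta> \<in> \<Phi>"
proof -
  have r: "\<beta> + \<alpha> \<in> \<Delta>"
    using pos_roots_sum_weight[OF ideal_roots_pos[OF assms(1)] assms(2,3)] by (simp add: add.commute)
  have "gs (\<beta> + \<alpha>) \<subseteq> \<ii>"
    using pos_roots_subset[OF assms(2)] nilradical_subset ideal_roots_subset[OF assms(1)]
    by (intro lie_mem_root_space_subset subspace_ideal pos_roots_roots[OF assms(2)]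
        ideal_roots_roots[OF assms(1)] r lie_ideal) blast+
  moreover have "\<beta> + \<alpha> \<in> P"
    using pos_roots_add assms(2) ideal_roots_pos[OF assms(1)] r by blast
  ultimately show ?thesis by (simp add: roots_of_def add.commute)
qed

text \<open>The string is climbed one step at a time; \<open>string_up\<close> supplies the weights
  and \<open>ideal_roots_add\<close> keeps them in \<Phi>.\<close>

lemma ideal_roots_string:
  assumes \<alpha>: "\<alpha> \<in> \<Phi>" and \<gamma>: "\<gamma> \<in> P" and "int i \<le> - cint \<alpha> \<gamma>"
  shows "\<alpha> + zmul (int i) \<gamma> \<in> \<Phi>"
  using assms(3)
proof (induction i)
  case 0
  have "\<alpha> + zmul (int 0) \<gamma> = \<alpha>" by simp
  then show ?case using \<alpha> by (simp only:)
next
  case (Suc i)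
  have eq: "\<alpha> + zmul (int (Suc i)) \<gamma> = \<alpha> + zmul (int i) \<gamma> + \<gamma>"
    by (simp add: fun_eq_iff algebra_simps)
  have "\<alpha> + zmul (int (Suc i)) \<gamma> \<in> weights"
    using Suc(2) by (intro string_up pos_roots_roots[OF \<gamma>] ideal_roots_weights[OF \<alpha>]) auto
  moreover have "\<alpha> + zmul (int i) \<gamma> \<in> \<Phi>" using Suc(2) by (intro Suc(1)) simp
  ultimately show ?case using ideal_roots_add[OF _ \<gamma>] by (simp only: eq)
qed

lemma reflection_ideal_root:
  assumes "\<alpha> \<in> \<Phi>" "\<gamma> \<in> P" "ip \<alpha> \<gamma> \<le> 0"
  shows "reflection \<gamma> \<alpha> \<in> \<Phi>"
proof -
  have "cint \<alpha> \<gamma> \<le> 0"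
    using cint_pos_iff[OF pos_roots_roots[OF assms(2)] ideal_roots_weights[OF assms(1)]] assms(3) by linarith
  then show ?thesis
    using ideal_roots_string[OF assms(1,2), of "nat (- cint \<alpha> \<gamma>)"] by (simp add: reflection_def zmul_minus)
qed

definition isum :: "('g \<Rightarrow> complex) \<Rightarrow> real" where
  "isum \<gamma> = pairing \<gamma> (kd (root_sum \<hh> \<nn> \<ii>))"

lemma isum_add: "isum (\<alpha> + \<beta>) = isum \<alpha> + isum \<beta>"
  by (simp add: isum_def pairing_def)

text \<open>The sum of the \<open>kd \<alpha>\<close> represents \<open>root_sum\<close>, which
  evaluates the \<open>THE\<close> in \<open>killing_dual\<close> there.\<close>

lemma isum_eq:
  assumes \<gamma>: "\<gamma> \<in> \<Delta>"
  shows "isum \<gamma> = (\<Sum>\<alpha>\<in>\<Phi>. ip \<alpha> \<gamma>)"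
proof -
  have mem: "kd \<alpha> \<in> \<hh>" if "\<alpha> \<in> \<Phi>" for \<alpha>
    using that killing_dual_root(1) ideal_roots_roots by blast
  have "kd (root_sum \<hh> \<nn> \<ii>) = (\<Sum>\<alpha>\<in>\<Phi>. kd \<alpha>)"
  proof (rule killing_dual_eqI)
    show "(\<Sum>\<alpha>\<in>\<Phi>. kd \<alpha>) \<in> \<hh>" using mem by (intro subspace_sum subspace_cartan)
    show "killing (\<Sum>\<alpha>\<in>\<Phi>. kd \<alpha>) z = root_sum \<hh> \<nn> \<ii> z" if "z \<in> \<hh>" for z
      unfolding killing_sum_left root_sum_def
      using that killing_dual_root(2) ideal_roots_roots by (intro sum.cong) auto
  qed
  then have "isum \<gamma> = (\<Sum>\<alpha>\<in>\<Phi>. ip \<gamma> \<alpha>)"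
    using dual_sum[OF roots_dual[OF \<gamma>], of \<Phi> kd, OF mem] by (simp add: isum_def ip_def pairing_def)
  then show ?thesis using \<gamma> ideal_roots_roots by (simp add: ip_commute)
qed

text \<open>
  The reflection in \<open>\<gamma>\<close> moves the roots of the ideal with negative product with \<open>\<gamma>\<close> to
  roots of the ideal with the opposite product; the surplus of the sum is what it does not reach.
\<close>

lemma isum_surplus:
  assumes \<gamma>: "\<gamma> \<in> P"
  shows "isum \<gamma> = (\<Sum>\<alpha> | \<alpha> \<in> \<Phi> \<and> ip \<alpha> \<gamma> > 0 \<and> reflection \<gamma> \<alpha> \<notin> \<Phi>. ip \<alpha> \<gamma>)"
proof -
  let ?A = "{\<alpha>\<in>\<Phi>. ip \<alpha> \<gamma> < 0}" and ?B = "{\<alpha>\<in>\<Phi>. ip \<alpha> \<gamma> > 0}" and ?C = "{\<alpha>\<in>\<Phi>. ip \<alpha> \<gamma> > 0 \<and> reflection \<gamma> \<alpha> \<notin> \<Phi>}"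
  note r = pos_roots_roots[OF \<gamma>]
  have RA: "reflection \<gamma> ` ?A = ?B - ?C"
  proof
    show "reflection \<gamma> ` ?A \<subseteq> ?B - ?C"
      using reflection_ideal_root[OF _ \<gamma>] ip_reflection[OF r] reflection_reflection[OF r] ideal_roots_weights by fastforce
    show "?B - ?C \<subseteq> reflection \<gamma> ` ?A"
    proof
      fix \<alpha> assume "\<alpha> \<in> ?B - ?C"
      then show "\<alpha> \<in> reflection \<gamma> ` ?A"
        using ip_reflection[OF r] reflection_reflection[OF r] ideal_roots_weights by (intro image_eqI[of _ _ "reflection \<gamma> \<alpha>"]) auto
    qed
  qed
  have inj: "inj_on (reflection \<gamma>) ?A"
    by (rule inj_on_inverseI[where g="reflection \<gamma>"]) (use reflection_reflection[OF r] ideal_roots_weights in auto)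
  have "(\<Sum>\<alpha>\<in>?B - ?C. ip \<alpha> \<gamma>) = (\<Sum>\<alpha>\<in>?A. ip (reflection \<gamma> \<alpha>) \<gamma>)"
    unfolding RA[symmetric] by (simp add: sum.reindex[OF inj])
  also have "\<dots> = - (\<Sum>\<alpha>\<in>?A. ip \<alpha> \<gamma>)"
    unfolding sum_negf[symmetric] using ip_reflection[OF r] ideal_roots_weights by (intro sum.cong) auto
  finally have 1: "(\<Sum>\<alpha>\<in>?B - ?C. ip \<alpha> \<gamma>) + (\<Sum>\<alpha>\<in>?A. ip \<alpha> \<gamma>) = 0" by simp
  have "isum \<gamma> = (\<Sum>\<alpha>\<in>?A \<union> ?B. ip \<alpha> \<gamma>)"
    unfolding isum_eq[OF r] by (intro sum.mono_neutral_right) auto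
  also have "\<dots> = (\<Sum>\<alpha>\<in>?A. ip \<alpha> \<gamma>) + (\<Sum>\<alpha>\<in>?B. ip \<alpha> \<gamma>)"
    by (intro sum.union_disjoint) auto
  also have "(\<Sum>\<alpha>\<in>?B. ip \<alpha> \<gamma>) = (\<Sum>\<alpha>\<in>?B - ?C. ip \<alpha> \<gamma>) + (\<Sum>\<alpha>\<in>?C. ip \<alpha> \<gamma>)"
    by (intro sum.subset_diff) auto
  finally show ?thesis using 1 by simp
qed

lemma isum_nonneg: "\<gamma> \<in> P \<Longrightarrow> isum \<gamma> \<ge> 0"
  unfolding isum_surplus by (intro sum_nonneg) auto

text \<open>In \<open>isum_surplus\<close> all terms are positive, so a vanishing sum has no
  terms.\<close>

lemma isum_zero_reflection:
  assumes \<gamma>: "\<gamma> \<in> P" and "isum \<gamma> = 0" and \<alpha>: "\<alpha> \<in> \<Phi>"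
  shows "reflection \<gamma> \<alpha> \<in> \<Phi>"
proof (rule ccontr)
  assume n: "reflection \<gamma> \<alpha> \<notin> \<Phi>"
  then have "ip \<alpha> \<gamma> > 0" using reflection_ideal_root[OF \<alpha> \<gamma>] by linarith
  moreover have "ip \<alpha> \<gamma> = 0"
    using assms(2) \<alpha> n calculation unfolding isum_surplus[OF \<gamma>]
    by (subst (asm) sum_nonneg_eq_0_iff) auto
  ultimately show False by simp
qed

text \<open>The reflection in \<beta> preserves \<Phi> and thus turns upward closure along
  \<beta>-strings into downward closure.\<close>

lemma ideal_roots_diff:
  assumes \<beta>: "\<beta> \<in> P" "isum \<beta> = 0" and \<alpha>: "\<alpha> \<in> \<Delta>" "\<alpha> + \<beta> \<in> \<Phi>"
  shows "\<alpha> \<in> \<Phi>"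
proof -
  let ?\<delta> = "\<alpha> + \<beta>"
  note r = pos_roots_roots[OF \<beta>(1)]
  have c: "cint ?\<delta> \<beta> = cint \<alpha> \<beta> + 2"
    using cint[OF r roots_weights[OF \<alpha>(1)]] root_coroot[OF r] by (intro cint_eqI r) simp
  show ?thesis
  proof (cases "cint ?\<delta> \<beta> > 0")
    case True
    \<comment> \<open>With \<open>c = cint ?\<delta> \<beta>\<close> the reflected root is
      \<open>?\<delta> - c \<beta>\<close>, so \<alpha> lies \<open>c - 1\<close> steps above
      it.\<close>
    let ?i = "nat (cint ?\<delta> \<beta> - 1)"
    have "reflection \<beta> ?\<delta> \<in> \<Phi>" using isum_zero_reflection \<beta> \<alpha>(2) by blast
    then have "reflection \<beta> ?\<delta> + zmul (int ?i) \<beta> \<in> \<Phi>"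
      using True cint_reflection[OF r ideal_roots_weights[OF \<alpha>(2)]] by (intro ideal_roots_string \<beta>(1)) auto
    moreover have "reflection \<beta> ?\<delta> + zmul (int ?i) \<beta> = \<alpha>"
      using True by (auto simp: reflection_def fun_eq_iff algebra_simps)
    ultimately show ?thesis by (simp only:)
  next
    case False
    \<comment> \<open>Here the reflection of \<alpha> is \<open>?\<delta> + (1 - c) \<beta>\<close>:
      \<open>- c\<close> steps are covered by \<open>ideal_roots_string\<close>, and the last one by
      the fact that the result is a root.\<close>
    let ?i = "nat (- cint ?\<delta> \<beta>)"
    have "?\<delta> + zmul (int ?i) \<beta> \<in> \<Phi>" using False by (intro ideal_roots_string \<alpha> \<beta>) auto
    moreover have eq: "?\<delta> + zmul (int ?i) \<beta> + \<beta> = reflection \<beta> \<alpha>"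
      using False c by (auto simp: reflection_def fun_eq_iff algebra_simps)
    moreover have "reflection \<beta> \<alpha> \<in> weights" using reflection_root[OF r \<alpha>(1)] by (rule roots_weights)
    ultimately have "reflection \<beta> \<alpha> \<in> \<Phi>" using ideal_roots_add[OF _ \<beta>(1)] by metis
    then have "reflection \<beta> (reflection \<beta> \<alpha>) \<in> \<Phi>" using isum_zero_reflection \<beta> by blast
    then show ?thesis using reflection_reflection[OF r roots_weights[OF \<alpha>(1)]] by simp
  qed
qed

section \<open>The algebra \<open>nils\<close> and its center\<close>

definition N :: "('g \<Rightarrow> complex) set" where
  "N = {\<gamma> \<in> P. isum \<gamma> > 0}"

abbreviation "nils \<equiv> nil_part \<hh> \<nn> (kd (root_sum \<hh> \<nn> \<ii>))"

lemma nils_eq: "nils = span (\<Union>\<alpha>\<in>N. gs \<alpha>)"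
  by (simp add: nil_part_def N_def isum_def)

lemma N_pos: "\<gamma> \<in> N \<Longrightarrow> \<gamma> \<in> P"
  and N_roots: "\<gamma> \<in> N \<Longrightarrow> \<gamma> \<in> \<Delta>"
  and N_weights: "\<gamma> \<in> N \<Longrightarrow> \<gamma> \<in> weights"
  using pos_roots_roots roots_weights by (auto simp: N_def)

lemma N_root_space: "\<gamma> \<in> N \<Longrightarrow> gs \<gamma> \<subseteq> nils"
  unfolding nils_eq by (rule order.trans[OF _ span_superset]) blast

lemma root_space_nils: assumes "gs \<alpha> \<subseteq> nils" "\<alpha> \<in> \<Delta>" shows "\<alpha> \<in> N"
proof (rule ccontr)
  assume "\<alpha> \<notin> N"
  obtain v where v: "v \<in> gs \<alpha>" "v \<noteq> 0" using root_vector[OF roots_weights[OF assms(2)]] .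
  then have "v = 0"
    using assms \<open>\<alpha> \<notin> N\<close> N_weights roots_weights unfolding nils_eq
    by (intro root_space_span_disjoint[of v \<alpha> N]) auto
  then show False using v by simp
qed

lemma nils_subset_nilradical: "nils \<subseteq> \<nn>"
  unfolding nils_eq using pos_roots_subset N_pos by (intro span_minimal subspace_nilradical) blast

lemma lie_cartan_nils: assumes "y \<in> \<hh>" "v \<in> nils" shows "lie y v \<in> nils"
proof -
  have "bracket (span \<hh>) (span (\<Union>\<alpha>\<in>N. gs \<alpha>)) \<subseteq> nils"
  proof (rule bracket_span_subset)
    fix y v assume "y \<in> \<hh>" "v \<in> (\<Union>\<alpha>\<in>N. gs \<alpha>)"
    then obtain \<alpha> where "\<alpha> \<in> N" "v \<in> gs \<alpha>" "lie y v = scale (\<alpha> y) v"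
      by (auto simp: root_space_def)
    then show "lie y v \<in> nils" using N_root_space unfolding nils_eq by (auto intro: span_scale)
  qed (simp add: nils_eq)
  then show ?thesis using assms lie_mem_bracket span_base unfolding nils_eq by blast
qed

lemma center_nils: "center nils \<subseteq> nils" "x \<in> center nils \<Longrightarrow> y \<in> nils \<Longrightarrow> lie x y = 0"
  by (auto simp: center_def)

text \<open>By Jacobi the center of an \<hh>-stable algebra is again \<hh>-stable.\<close>

lemma center_nils_eq_span: "center nils = span (\<Union>\<alpha>\<in>roots_of \<hh> \<nn> (center nils). gs \<alpha>)"
proof (rule hstable_eq_span_roots)
  have "subspace nils" by (simp add: nils_eq)
  then have "subspace (center nils)"
    by (intro subspaceI) (auto simp: center_def subspace_0 subspace_add subspace_scale lie_add_left lie_scale_left)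
  moreover have "lie y v \<in> center nils" if "y \<in> \<hh>" "v \<in> center nils" for y v
    using that lie_cartan_nils by (auto simp: center_def lie_lie_left)
  ultimately show "hstable (center nils)" by (simp add: hstable_def)
  show "center nils \<subseteq> \<nn>" using center_nils(1) nils_subset_nilradical by blast
qed

text \<open>Roots in \<open>N\<close> have level 1 or 2 and no weight exceeds level 2, so brackets
  of \<open>nils\<close> land in \<ii> and \<ii> is central. The remaining inclusion excludes
  central roots of level 1.\<close>

lemma graded_imp_center:
  assumes highest: "is_highest_root \<hh> \<nn> \<theta>" and \<tau>: "\<tau> \<in> X \<hh> \<nn> \<theta>" and eq: "\<Phi> = graded_roots \<hh> \<nn> \<tau> 2"
  shows "bracket nils nils \<subseteq> \<ii> \<and> \<ii> = center nils"
proof -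
  define lev where "lev \<alpha> = pairing \<alpha> \<tau>" for \<alpha>
  have lev_add: "lev (\<alpha> + \<beta>) = lev \<alpha> + lev \<beta>" and lev_diff: "lev (\<alpha> - \<beta>) = lev \<alpha> - lev \<beta>"
    and lev_zmul: "lev (zmul m \<alpha>) = of_int m * lev \<alpha>" and lev_minus: "lev (- \<alpha>) = - lev \<alpha>" for \<alpha> \<beta> m
    by (auto simp: lev_def pairing_def)
  have simple: "pairing \<alpha> \<tau> \<ge> 0" if "\<alpha> \<in> simple_roots \<hh> \<nn>" for \<alpha> using \<tau> that by (auto simp: X_def)
  have lev_int: "lev \<alpha> \<in> \<int>" if "\<alpha> \<in> \<Delta>" for \<alpha>
    using \<tau> that by (auto simp: X_def coweight_lattice_def lev_def)
  have lev_nonneg: "lev \<alpha> \<ge> 0" if "\<alpha> \<in> P" for \<alpha>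
    using dominant_nonneg[OF simple that] by (simp add: lev_def)
  have lev_le: "lev \<alpha> \<le> 2" if "\<alpha> \<in> weights" for \<alpha>
  proof (cases "\<alpha> = 0")
    case False
    then have "\<alpha> \<in> \<Delta>" using that weights_cases by blast
    then show ?thesis using pairing_le_highest[OF simple highest] \<tau> by (fastforce simp: lev_def X_def)
  qed (simp add: lev_def pairing_def)
  have lev_pos: "\<alpha> \<in> P" if "\<alpha> \<in> \<Delta>" "lev \<alpha> > 0" for \<alpha>
    using pos_roots_total[OF that(1)] lev_nonneg[of "- \<alpha>"] that(2) by (auto simp: lev_minus)
  have \<Phi>_iff: "\<alpha> \<in> \<Phi> \<longleftrightarrow> \<alpha> \<in> P \<and> lev \<alpha> = 2" for \<alpha> by (simp add: eq graded_roots_def lev_def)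
  \<comment> \<open>Reflection in a root of level zero preserves levels, hence \<Phi>, while it
    negates products with \<gamma>.\<close>
  have isum0: "isum \<gamma> = 0" if \<gamma>: "\<gamma> \<in> P" "lev \<gamma> = 0" for \<gamma>
  proof -
    note r = pos_roots_roots[OF \<gamma>(1)]
    have "reflection \<gamma> \<alpha> \<in> \<Phi>" if "\<alpha> \<in> \<Phi>" for \<alpha>
      using that lev_pos[OF reflection_root[OF r ideal_roots_roots[OF that]]] \<gamma>(2)
      by (simp add: \<Phi>_iff reflection_def lev_diff lev_zmul)
    then have "bij_betw (reflection \<gamma>) \<Phi> \<Phi>"
      using reflection_reflection[OF r ideal_roots_weights] by (intro bij_betw_byWitness[where f'="reflection \<gamma>"]) auto
    then have "isum \<gamma> = (\<Sum>\<alpha>\<in>\<Phi>. ip (reflection \<gamma> \<alpha>) \<gamma>)"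
      unfolding isum_eq[OF r] by (rule sum.reindex_bij_betw[symmetric])
    also have "\<dots> = - isum \<gamma>"
      unfolding isum_eq[OF r] sum_negf[symmetric] using ip_reflection[OF r] ideal_roots_weights by (intro sum.cong) auto
    finally show ?thesis by simp
  qed
  have N_lev: "lev \<gamma> \<ge> 1" if \<gamma>: "\<gamma> \<in> N" for \<gamma>
  proof -
    have "lev \<gamma> \<noteq> 0" "lev \<gamma> \<ge> 0" using \<gamma> isum0 lev_nonneg by (auto simp: N_def)
    moreover obtain z where "lev \<gamma> = of_int z" using lev_int[OF N_roots[OF \<gamma>]] by (auto elim: Ints_cases)
    ultimately show ?thesis by simp
  qed
  \<comment> \<open>A root of \<Phi> with negative product with \<gamma> would give a weight of
    level at least 3, so one positive product makes the whole sum positive.\<close>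
  have isum_pos: "\<gamma> \<in> N" if \<gamma>: "\<gamma> \<in> P" "lev \<gamma> \<ge> 1" and \<alpha>: "\<alpha> \<in> \<Phi>" "ip \<alpha> \<gamma> > 0" for \<gamma> \<alpha>
  proof -
    note r = pos_roots_roots[OF \<gamma>(1)]
    have "ip \<beta> \<gamma> \<ge> 0" if \<beta>: "\<beta> \<in> \<Phi>" for \<beta>
    proof (rule ccontr)
      assume "\<not> ?thesis"
      then have "\<beta> + \<gamma> \<in> weights" using root_add_weight[OF r ideal_roots_weights[OF \<beta>]] by simp
      then show False using lev_le[of "\<beta> + \<gamma>"] \<gamma>(2) \<beta> by (simp add: lev_add \<Phi>_iff)
    qed
    then have "isum \<gamma> > 0" unfolding isum_eq[OF r] using \<alpha> by (intro sum_pos2[of _ \<alpha>]) auto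
    then show ?thesis using \<gamma> by (simp add: N_def)
  qed
  have \<Phi>N: "\<alpha> \<in> N" if "\<alpha> \<in> \<Phi>" for \<alpha>
    using that ip_pos(1)[OF ideal_roots_roots[OF that]] by (intro isum_pos[OF _ _ that]) (auto simp: \<Phi>_iff)
  have "bracket nils nils \<subseteq> \<ii>"
    unfolding nils_eq
  proof (rule bracket_span_subset[OF subspace_ideal])
    fix x y assume "x \<in> (\<Union>\<alpha>\<in>N. gs \<alpha>)" "y \<in> (\<Union>\<alpha>\<in>N. gs \<alpha>)"
    then obtain \<alpha> \<beta> where *: "\<alpha> \<in> N" "x \<in> gs \<alpha>" "\<beta> \<in> N" "y \<in> gs \<beta>" by auto
    have "lie x y \<in> span (\<Union>\<gamma>\<in>\<Phi>. gs \<gamma>)"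
    proof (rule lie_in_root_span[OF *(2,4) N_weights[OF *(1)] N_weights[OF *(3)]])
      assume w: "\<alpha> + \<beta> \<in> weights"
      have "lev (\<alpha> + \<beta>) = 2" using N_lev[OF *(1)] N_lev[OF *(3)] lev_le[OF w] by (simp add: lev_add)
      then show "\<alpha> + \<beta> \<in> \<Phi>"
        using lev_pos[of "\<alpha> + \<beta>"] pos_roots_sum_weight[OF N_pos[OF *(1)] N_pos[OF *(3)] w]
        by (simp add: \<Phi>_iff)
    qed
    then show "lie x y \<in> \<ii>" by (simp only: ideal_eq_span[symmetric])
  qed
  moreover have "\<ii> \<subseteq> center nils"
  proof
    fix x assume x: "x \<in> \<ii>"
    have "bracket (span (\<Union>\<alpha>\<in>\<Phi>. gs \<alpha>)) (span (\<Union>\<alpha>\<in>N. gs \<alpha>)) \<subseteq> {0}"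
    proof (rule bracket_span_subset)
      fix x y assume "x \<in> (\<Union>\<alpha>\<in>\<Phi>. gs \<alpha>)" "y \<in> (\<Union>\<alpha>\<in>N. gs \<alpha>)"
      then obtain \<alpha> \<beta> where *: "\<alpha> \<in> \<Phi>" "x \<in> gs \<alpha>" "\<beta> \<in> N" "y \<in> gs \<beta>" by auto
      have "lie x y \<in> span (\<Union>\<gamma>\<in>{}. gs \<gamma>)"
      proof (rule lie_in_root_span[OF *(2,4) ideal_roots_weights[OF *(1)] N_weights[OF *(3)]])
        assume "\<alpha> + \<beta> \<in> weights"
        then show "\<alpha> + \<beta> \<in> {}" using lev_le[of "\<alpha> + \<beta>"] N_lev[OF *(3)] *(1) by (simp add: lev_add \<Phi>_iff)
      qed
      then show "lie x y \<in> {0}" by simp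
    qed simp
    moreover have "x \<in> span (\<Union>\<alpha>\<in>\<Phi>. gs \<alpha>)" using x ideal_eq_span by blast
    ultimately have "lie x y = 0" if "y \<in> nils" for y
      using that lie_mem_bracket unfolding nils_eq by blast
    moreover have "span (\<Union>\<alpha>\<in>\<Phi>. gs \<alpha>) \<subseteq> nils"
      unfolding nils_eq using \<Phi>N by (intro span_mono) blast
    ultimately show "x \<in> center nils"
      using \<open>x \<in> span (\<Union>\<alpha>\<in>\<Phi>. gs \<alpha>)\<close> by (auto simp: center_def)
  qed
  moreover have "gs \<alpha> \<subseteq> \<ii>" if "\<alpha> \<in> roots_of \<hh> \<nn> (center nils)" for \<alpha>
  proof -
    have \<alpha>: "\<alpha> \<in> P" "gs \<alpha> \<subseteq> center nils" using that by (auto simp: roots_of_def)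
    note r = pos_roots_roots[OF \<alpha>(1)]
    have N: "\<alpha> \<in> N" using root_space_nils[OF _ r] \<alpha>(2) center_nils(1) by blast
    have "lev \<alpha> = 2"
    proof (rule ccontr)
      assume "lev \<alpha> \<noteq> 2"
      moreover obtain z where "lev \<alpha> = of_int z" using lev_int[OF r] by (auto elim: Ints_cases)
      ultimately have l1: "lev \<alpha> = 1" using N_lev[OF N] lev_le[OF N_weights[OF N]] by simp
      have "isum \<alpha> > 0" using N by (simp add: N_def)
      then obtain \<beta> where \<beta>: "\<beta> \<in> \<Phi>" "ip \<beta> \<alpha> > 0"
        unfolding isum_eq[OF r] using sum_nonpos[of \<Phi> "\<lambda>\<beta>. ip \<beta> \<alpha>"] by (metis not_le)
      note r\<beta> = ideal_roots_roots[OF \<beta>(1)]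
      have ip: "ip \<alpha> \<beta> > 0" using \<beta>(2) ip_commute[OF r r\<beta>] by simp
      have lev_\<beta>: "lev \<beta> = 2" using \<beta>(1) by (simp add: \<Phi>_iff)
      let ?\<delta> = "\<beta> - \<alpha>"
      have "?\<delta> \<noteq> 0" using l1 lev_\<beta> by auto
      moreover have "?\<delta> \<in> weights" using root_diff_weight[OF r roots_weights[OF r\<beta>] \<beta>(2)] .
      ultimately have \<delta>: "?\<delta> \<in> \<Delta>" using weights_cases by blast
      have \<delta>1: "lev ?\<delta> = 1" using l1 lev_\<beta> by (simp add: lev_diff)
      have \<delta>P: "?\<delta> \<in> P" using lev_pos[OF \<delta>] \<delta>1 by simp
      \<comment> \<open>The bound on levels forces the Cartan integer to be 1, whence
        \<open>2 (\<alpha>, \<beta>) = (\<beta>, \<beta>)\<close> and the product of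
        \<open>?\<delta>\<close> with \<beta> is positive too.\<close>
      have "lev (- reflection \<beta> \<alpha>) = 2 * of_int (cint \<alpha> \<beta>) - 1"
        using l1 lev_\<beta> by (simp add: reflection_def lev_diff lev_zmul lev_minus)
      moreover have "lev (- reflection \<beta> \<alpha>) \<le> 2"
        by (intro lev_le roots_weights roots_uminus reflection_root r r\<beta>)
      ultimately have "cint \<alpha> \<beta> \<le> 1" by linarith
      moreover have "cint \<alpha> \<beta> > 0" using ip cint_pos_iff[OF r\<beta> roots_weights[OF r]] by simp
      ultimately have "2 * ip \<alpha> \<beta> = ip \<beta> \<beta>" using ip_cint[OF r\<beta> roots_weights[OF r]] by simp
      then have "ip ?\<delta> \<beta> > 0" using ip by (simp add: ip_diff)
      then have "?\<delta> \<in> N"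
        using \<delta>P \<delta>1 \<beta>(1) ip_commute[OF \<delta> r\<beta>] by (intro isum_pos[of _ \<beta>]) auto
      obtain x where x: "x \<in> gs \<alpha>" "x \<noteq> 0" using root_vector[OF roots_weights[OF r]] .
      obtain y where y: "y \<in> gs ?\<delta>" "y \<noteq> 0" using root_vector[OF roots_weights[OF \<delta>]] .
      \<comment> \<open>The weights of \<open>x\<close> and \<open>y\<close> add up to the root
        \<beta>, whereas \<open>x\<close> is central and \<open>y\<close> lies in
        \<open>nils\<close>.\<close>
      have "lie x y \<noteq> 0"
        using r\<beta> by (intro lie_root_vectors_nonzero[OF r \<delta> _ x y]) simp
      moreover have "lie x y = 0"
        using x y \<alpha>(2) N_root_space[OF \<open>?\<delta> \<in> N\<close>] by (intro center_nils(2)) auto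
      ultimately show False by simp
    qed
    then have "\<alpha> \<in> \<Phi>" using \<alpha>(1) by (simp add: \<Phi>_iff)
    then show ?thesis by (rule ideal_roots_subset)
  qed
  then have "span (\<Union>\<alpha>\<in>roots_of \<hh> \<nn> (center nils). gs \<alpha>) \<subseteq> \<ii>"
    by (intro span_minimal subspace_ideal) blast
  then have "center nils \<subseteq> \<ii>" using center_nils_eq_span by (simp only:)
  ultimately show ?thesis by blast
qed

section \<open>The grading determined by the ideal\<close>

definition plevel :: "('g \<Rightarrow> complex) \<Rightarrow> int" where
  "plevel \<alpha> = (if \<alpha> \<in> \<Phi> then 2 else if \<alpha> \<in> N then 1 else 0)"

text \<open>The odd extension of \<open>plevel\<close> to all roots; \<open>plevel\<close> vanishes
  on negative roots.\<close>

definition level :: "('g \<Rightarrow> complex) \<Rightarrow> int" where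
  "level \<alpha> = plevel \<alpha> - plevel (- \<alpha>)"

lemma level_uminus: "level (- \<alpha>) = - level \<alpha>"
  by (simp add: level_def)

lemma level_0: "level 0 = 0"
  by (simp add: level_def)

lemma level_pos: "\<alpha> \<in> P \<Longrightarrow> level \<alpha> = plevel \<alpha>"
  using pos_roots_uminus[of \<alpha>] ideal_roots_pos N_pos by (auto simp: level_def plevel_def)

text \<open>\<open>level\<close> is additive on weights, hence compatible with reflections, and
  \<open>coweight_of_reflection_equivariant\<close> realises it as the pairing with a
  coweight.\<close>

lemma center_imp_graded:
  assumes br: "bracket nils nils \<subseteq> \<ii>" and ce: "\<ii> = center nils" and highest: "is_highest_root \<hh> \<nn> \<theta>"
  shows "\<exists>\<tau>\<in>X \<hh> \<nn> \<theta>. \<Phi> = graded_roots \<hh> \<nn> \<tau> 2"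
proof -
  have \<Phi>N: "\<alpha> \<in> N" if "\<alpha> \<in> \<Phi>" for \<alpha>
    using ideal_roots_subset[OF that] ce center_nils(1) by (intro root_space_nils ideal_roots_roots[OF that]) blast
  \<comment> \<open>The sum lies in \<Phi> by the bracket condition. Neither summand does, since
    root vectors of \<Phi> are central in \<open>nils\<close> and this bracket is non-zero.\<close>
  have NN: "\<alpha> + \<beta> \<in> \<Phi>" "\<alpha> \<notin> \<Phi>" "\<beta> \<notin> \<Phi>" if ab: "\<alpha> \<in> N" "\<beta> \<in> N" "\<alpha> + \<beta> \<in> \<Delta>" for \<alpha> \<beta>
  proof -
    have "lie x y \<in> \<ii>" if "x \<in> gs \<alpha>" "y \<in> gs \<beta>" for x y
      using that \<open>\<alpha> \<in> N\<close> \<open>\<beta> \<in> N\<close> N_root_space lie_mem_bracket br by blast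
    then have "gs (\<alpha> + \<beta>) \<subseteq> \<ii>"
      by (intro lie_mem_root_space_subset subspace_ideal N_roots[OF ab(1)] N_roots[OF ab(2)] ab(3))
    moreover have "\<alpha> + \<beta> \<in> P" using ab by (intro pos_roots_add N_pos)
    ultimately show "\<alpha> + \<beta> \<in> \<Phi>" by (simp add: roots_of_def)
    obtain x where x: "x \<in> gs \<alpha>" "x \<noteq> 0" using root_vector[OF N_weights[OF ab(1)]] .
    obtain y where y: "y \<in> gs \<beta>" "y \<noteq> 0" using root_vector[OF N_weights[OF ab(2)]] .
    have nz: "lie x y \<noteq> 0"
      using lie_root_vectors_nonzero[OF N_roots[OF ab(1)] N_roots[OF ab(2)] ab(3) x y] .
    have mem: "x \<in> nils" "y \<in> nils" using x y ab N_root_space by blast+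
    show "\<alpha> \<notin> \<Phi>"
      using nz center_nils(2)[of x y] mem x ideal_roots_subset[of \<alpha>] ce by blast
    show "\<beta> \<notin> \<Phi>"
      using nz center_nils(2)[of y x] lie_anticomm[of x y] mem y ideal_roots_subset[of \<beta>] ce by auto
  qed
  have P0: "isum \<beta> = 0" if "\<beta> \<in> P" "\<beta> \<notin> N" for \<beta>
    using that isum_nonneg[of \<beta>] by (simp add: N_def)
  \<comment> \<open>Adding a root with vanishing \<open>isum\<close> changes neither membership in
    \<open>N\<close> nor, by \<open>ideal_roots_diff\<close> and \<open>ideal_roots_add\<close>,
    membership in \<Phi>.\<close>
  have mixed: "plevel (\<alpha> + \<beta>) = plevel \<alpha> + plevel \<beta>"
    if "\<alpha> \<in> P" "\<beta> \<in> P" "\<alpha> + \<beta> \<in> \<Delta>" "\<beta> \<notin> N" for \<alpha> \<beta>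
  proof -
    have "\<alpha> + \<beta> \<in> N \<longleftrightarrow> \<alpha> \<in> N"
      using pos_roots_add[OF that(1-3)] that P0[of \<beta>] by (simp add: N_def isum_add)
    moreover have "\<alpha> + \<beta> \<in> \<Phi> \<longleftrightarrow> \<alpha> \<in> \<Phi>"
      using ideal_roots_diff[OF that(2) P0[OF that(2,4)] pos_roots_roots[OF that(1)]]
        ideal_roots_add[OF _ that(2) roots_weights[OF that(3)]] by blast
    ultimately show ?thesis using that(4) \<Phi>N by (auto simp: plevel_def)
  qed
  have add: "plevel (\<alpha> + \<beta>) = plevel \<alpha> + plevel \<beta>" if "\<alpha> \<in> P" "\<beta> \<in> P" "\<alpha> + \<beta> \<in> \<Delta>" for \<alpha> \<beta>
  proof (cases "\<alpha> \<in> N \<and> \<beta> \<in> N")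
    case True
    then show ?thesis using NN[of \<alpha> \<beta>] that(3) by (simp add: plevel_def)
  next
    case False
    then show ?thesis using mixed[of \<alpha> \<beta>] mixed[of \<beta> \<alpha>] that by (auto simp: add.commute)
  qed
  have PP: "level \<alpha> + level \<beta> = level (\<alpha> + \<beta>)" if "\<alpha> \<in> P" "\<beta> \<in> P" "\<alpha> + \<beta> \<in> \<Delta>" for \<alpha> \<beta>
    using add[OF that] pos_roots_add[OF that] that by (simp add: level_pos)
  have same: "level \<alpha> + level \<beta> = level (\<alpha> + \<beta>)"
    if "\<alpha> \<in> P \<and> \<beta> \<in> P \<or> - \<alpha> \<in> P \<and> - \<beta> \<in> P" "\<alpha> + \<beta> \<in> \<Delta>" for \<alpha> \<beta>
    using that(1)
  proof
    assume "- \<alpha> \<in> P \<and> - \<beta> \<in> P"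
    moreover have m: "- \<alpha> + - \<beta> = - (\<alpha> + \<beta>)" by simp
    ultimately have "level (- \<alpha>) + level (- \<beta>) = level (- (\<alpha> + \<beta>))"
      using PP[of "- \<alpha>" "- \<beta>"] roots_uminus[OF that(2)] by metis
    then show ?thesis unfolding level_uminus by simp
  qed (use PP that in blast)
  have lev_add: "level (\<alpha> + \<beta>) = level \<alpha> + level \<beta>"
    if w: "\<alpha> \<in> weights" "\<beta> \<in> weights" "\<alpha> + \<beta> \<in> weights" for \<alpha> \<beta>
  proof (cases "\<alpha> = 0 \<or> \<beta> = 0 \<or> \<alpha> + \<beta> = 0")
    case True
    moreover have "level \<beta> = - level \<alpha>" if "\<alpha> + \<beta> = 0"
      using that level_uminus[of \<alpha>] by (simp add: add_eq_0_iff)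
    ultimately show ?thesis by (auto simp: level_0)
  next
    case False
    then have r: "\<alpha> \<in> \<Delta>" "\<beta> \<in> \<Delta>" "\<alpha> + \<beta> \<in> \<Delta>" using w weights_cases by blast+
    \<comment> \<open>Of the three roots \<open>\<alpha>\<close>, \<open>\<beta>\<close>,
      \<open>- (\<alpha> + \<beta>)\<close> two have the same sign; the relation is rewritten as a
      sum of these two.\<close>
    consider "\<alpha> \<in> P \<and> \<beta> \<in> P \<or> - \<alpha> \<in> P \<and> - \<beta> \<in> P"
      | "\<alpha> + \<beta> \<in> P \<and> - \<alpha> \<in> P \<or> - (\<alpha> + \<beta>) \<in> P \<and> - (- \<alpha>) \<in> P"
      | "\<alpha> + \<beta> \<in> P \<and> - \<beta> \<in> P \<or> - (\<alpha> + \<beta>) \<in> P \<and> - (- \<beta>) \<in> P"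
      using r[THEN pos_roots_total] by auto
    then show ?thesis
    proof cases
      case 1
      then show ?thesis using same r(3) by simp
    next
      case 2
      have "\<alpha> + \<beta> + - \<alpha> = \<beta>" by simp
      then have "level (\<alpha> + \<beta>) + level (- \<alpha>) = level \<beta>" using same[OF 2] r(2) by metis
      then show ?thesis by (simp add: level_uminus)
    next
      case 3
      have "\<alpha> + \<beta> + - \<beta> = \<alpha>" by simp
      then have "level (\<alpha> + \<beta>) + level (- \<beta>) = level \<alpha>" using same[OF 3] r(1) by metis
      then show ?thesis by (simp add: level_uminus)
    qed
  qed
  \<comment> \<open>Additivity holds only between weights, so the string is descended one root at a
    time.\<close>
  have down: "level (\<beta> - zmul (int i) \<alpha>) = level \<beta> - int i * level \<alpha>"
    if "\<alpha> \<in> \<Delta>" "\<beta> \<in> weights" "int i \<le> cint \<beta> \<alpha>" for \<alpha> \<beta> i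
    using that(3)
  proof (induction i)
    case 0
    have "\<beta> - zmul (int 0) \<alpha> = \<beta>" by simp
    then show ?case by simp
  next
    case (Suc i)
    let ?\<gamma> = "\<beta> - zmul (int (Suc i)) \<alpha>"
    have w: "?\<gamma> \<in> weights" "\<beta> - zmul (int i) \<alpha> \<in> weights"
      using string_down[OF that(1,2), of "int (Suc i)"] string_down[OF that(1,2), of "int i"] Suc(2) by auto
    have eq: "?\<gamma> + \<alpha> = \<beta> - zmul (int i) \<alpha>" by (auto simp: fun_eq_iff algebra_simps)
    have "level (?\<gamma> + \<alpha>) = level ?\<gamma> + level \<alpha>"
      using w eq by (intro lev_add roots_weights[OF that(1)]) (auto simp only:)
    then have "level ?\<gamma> = level \<beta> - int i * level \<alpha> - level \<alpha>" using Suc unfolding eq by simp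
    then show ?case by (simp only: of_nat_Suc) (simp add: algebra_simps)
  qed
  have refl: "level (reflection \<alpha> \<beta>) = level \<beta> - cint \<beta> \<alpha> * level \<alpha>" if "\<alpha> \<in> \<Delta>" "\<beta> \<in> \<Delta>" for \<alpha> \<beta>
  proof (cases "cint \<beta> \<alpha> \<ge> 0")
    case True
    then show ?thesis using down[OF that(1) roots_weights[OF that(2)], of "nat (cint \<beta> \<alpha>)"] by (simp add: reflection_def)
  next
    case False
    then show ?thesis
      \<comment> \<open>For a negative Cartan integer the descent goes along
        \<open>- \<alpha>\<close>.\<close>
      using down[OF roots_uminus[OF that(1)] roots_weights[OF that(2)], of "nat (- cint \<beta> \<alpha>)"]
        cint_uminus[OF that(1) roots_weights[OF that(2)]]
      by (simp add: reflection_def zmul_minus zmul_uminus_right level_uminus)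
  qed
  obtain \<tau> where \<tau>: "\<tau> \<in> coweight_lattice \<hh>" "\<And>\<alpha>. \<alpha> \<in> \<Delta> \<Longrightarrow> pairing \<alpha> \<tau> = of_int (level \<alpha>)"
    using coweight_of_reflection_equivariant[of level, OF refl] by blast
  have "pairing \<alpha> \<tau> \<ge> 0" if "\<alpha> \<in> simple_roots \<hh> \<nn>" for \<alpha>
  proof -
    have "\<alpha> \<in> P" using that by (simp add: simple_roots_def)
    then show ?thesis using \<tau>(2)[OF pos_roots_roots] level_pos[of \<alpha>] by (simp add: plevel_def)
  qed
  moreover have "pairing \<theta> \<tau> \<le> 2"
  proof -
    have "\<theta> \<in> \<Delta>" using highest by (simp add: is_highest_root_def)
    moreover have "level \<theta> \<le> 2" by (simp add: level_def plevel_def)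
    ultimately show ?thesis using \<tau>(2) by simp
  qed
  ultimately have "\<tau> \<in> X \<hh> \<nn> \<theta>" using \<tau>(1) by (simp add: X_def)
  moreover have "\<Phi> = graded_roots \<hh> \<nn> \<tau> 2"
  proof -
    have "\<alpha> \<in> \<Phi> \<longleftrightarrow> pairing \<alpha> \<tau> = 2" if "\<alpha> \<in> P" for \<alpha>
      using that \<tau>(2)[OF pos_roots_roots[OF that]] level_pos[OF that] by (simp add: plevel_def)
    then show ?thesis using ideal_roots_pos by (auto simp: graded_roots_def)
  qed
  ultimately show ?thesis by blast
qed

end

theorem theorem3p3:
  fixes scale :: "complex \<Rightarrow> 'g::ab_group_add \<Rightarrow> 'g"
    and lie :: "'g \<Rightarrow> 'g \<Rightarrow> 'g"
    and \<hh> \<bb> \<nn> \<ii> :: "'g set"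
    and \<theta> :: "'g \<Rightarrow> complex"
  assumes "lie_algebra scale lie"
    and "lie_algebra.simple scale lie"
    and "lie_algebra.cartan_subalgebra scale lie \<hh>"
    and "lie_algebra.borel_subalgebra scale lie \<bb>"
    and "lie_algebra.is_nilradical scale lie \<nn> \<bb>"
    and "lie_algebra.is_direct_sum \<bb> \<hh> \<nn>"
    and "lie_algebra.is_highest_root scale lie \<hh> \<nn> \<theta>"
    and "lie_algebra.ideal scale lie \<ii> \<bb>"
    and "lie_algebra.abelian lie \<ii>"
  shows "(let N = lie_algebra.nil_part scale lie \<hh> \<nn>
                    (lie_algebra.killing_dual scale lie \<hh>
                      (lie_algebra.root_sum scale lie \<hh> \<nn> \<ii>))
          in lie_algebra.bracket scale lie N N \<subseteq> \<ii> \<and> \<ii> = lie_algebra.center lie N)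
     \<longleftrightarrow> (\<exists>\<tau> \<in> lie_algebra.X scale lie \<hh> \<nn> \<theta>.
            lie_algebra.roots_of scale lie \<hh> \<nn> \<ii> = lie_algebra.graded_roots scale lie \<hh> \<nn> \<tau> 2)"
proof -
  interpret lie_algebra scale lie by fact
  interpret abelian_ideal_data scale lie \<hh> \<bb> \<nn> \<ii>
    by unfold_locales (use assms in auto)
  show ?thesis
    unfolding Let_def using graded_imp_center center_imp_graded assms(7) by blast
qed

end
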